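(* 1. For every graph $G$, $$\left\lceil \frac{\chi(G)}{3} \right\rceil \le \chi_1(G) \le \chi(G)\qquad\text{and}\qquad \left\lceil \frac{\omega(G)}{3} \right\rceil \le \omega_1(G) \le \omega(G).$$ All these bounds are tight, for all possible values of $\chi$ and $\omega$ (i.e. for each of the four inequalities and every integer $k\ge 1$ there is a graph $G$ with $\chi(G)=k$, respectively $\omega(G)=k$, for which the inequality holds with equality). 2. For every graph $G$ without isolated vertices, $\theta(G)\leq\theta_1(G)\leq 3\theta(G)$, and the upper bound is tight. 3. For every graph $G$, $a(G)/2 \leq \chi_1(G) \leq a(G)$, and both bounds are tight. 4. Let $k$ be any positive integer. If $\Delta(G) < 3k$, then $\chi_1(G)\leq k$; that is, every graph $G$ satisfies $\chi_1(G) \leq \left\lceil \frac{\Delta(G)+1}{3} \right\rceil$. Moreover, the bounds are tight for both $\Delta$ and $\chi_1$: for every positive integer $k$ there exists a graph $G_k$ with $\Delta(G_k)=3k$ and $\chi_1(G_k)=k+1$. 5. Every $d$-degenerate graph $G$ satisfies $\chi_1(G) \leq d/2 + 1$. Moreover, this upper bound is tight: for every $k\geq 1$ there exists a graph $H_k$ such that $H_k$ is $2k$-degenerate and $\chi_1(H_k)=k+1$. 6. If $\Delta(G)>1$, then $\chi_1'(G)\leq\chi'(G)-2$ and, moreover, $$\delta(G) - 2 \leq \chi_1'(G) \leq \Delta(G) - 1.$$ All these bounds are tight.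
   Context: All graphs are finite and simple (with at least one vertex). $\chi,\omega,\theta,\chi',\delta,\Delta$ denote the chromatic number, clique number, clique covering number (minimum number of cliques partitioning the vertex set), chromatic index, minimum degree and maximum degree. A 1-selection in a graph $G=(V,E)$ is a mapping $f:V\to E\cup\{\varnothing\}$, not necessarily injective, such that $v\in f(v)$ for every $v\in V$ with $f(v)\ne\varnothing$. The 1-removed subgraph $G_f$ has vertex set $V$ and edge set $E\setminus f(V)$. With minimum and maximum taken over all 1-selections $f$ on $G$: $\chi_1(G)=\min_f\chi(G_f)$, $\omega_1(G)=\min_f\omega(G_f)$, $\theta_1(G)=\max_f\theta(G_f)$, $\chi_1'(G)=\min_f\chi'(G_f)$. The vertex arboricity $a(G)$ is the minimum number of classes in a partition of $V(G)$ such that each class induces a forest in $G$. A graph $G$ is $d$-degenerate ($d$ a non-negative integer) if every induced subgraph $G'$ of $G$ satisfies $\delta(G')\le d$. A bound is called tight if it is attained with equality by some graph satisfying the hypotheses. *)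

theory Defs
  imports Complex_Main "HOL-Library.FuncSet" "HOL-Library.Disjoint_Sets" "HOL-Library.Ramsey"
begin

record 'a graph =
  verts :: "'a set"
  edges :: "'a set set"

definition simple_graph :: "'a graph \<Rightarrow> bool" where
  "simple_graph G \<longleftrightarrow> finite (verts G) \<and> verts G \<noteq> {} \<and> edges G \<subseteq> [verts G]\<^bsup>2\<^esup>"

definition induced_subgraph :: "'a graph \<Rightarrow> 'a set \<Rightarrow> 'a graph" where
  "induced_subgraph G W = \<lparr>verts = W, edges = {e \<in> edges G. e \<subseteq> W}\<rparr>"

definition degree :: "'a graph \<Rightarrow> 'a \<Rightarrow> nat" where
  "degree G v = card {e \<in> edges G. v \<in> e}"

definition min_degree :: "'a graph \<Rightarrow> nat" where
  "min_degree G = Min (degree G ` verts G)"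

definition max_degree :: "'a graph \<Rightarrow> nat" where
  "max_degree G = Max (degree G ` verts G)"

definition no_isolated_vertices :: "'a graph \<Rightarrow> bool" where
  "no_isolated_vertices G \<longleftrightarrow> (\<forall>v\<in>verts G. \<exists>e\<in>edges G. v \<in> e)"

definition proper_colouring :: "'a graph \<Rightarrow> nat \<Rightarrow> ('a \<Rightarrow> nat) \<Rightarrow> bool" where
  "proper_colouring G k c \<longleftrightarrow>
     c \<in> verts G \<rightarrow> {..<k} \<and> (\<forall>u v. {u, v} \<in> edges G \<longrightarrow> c u \<noteq> c v)"

definition chromatic_number :: "'a graph \<Rightarrow> nat" where
  "chromatic_number G = (LEAST k. \<exists>c. proper_colouring G k c)"

definition proper_edge_colouring :: "'a graph \<Rightarrow> nat \<Rightarrow> ('a set \<Rightarrow> nat) \<Rightarrow> bool" where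
  "proper_edge_colouring G k c \<longleftrightarrow>
     c \<in> edges G \<rightarrow> {..<k} \<and>
     (\<forall>e\<in>edges G. \<forall>e'\<in>edges G. e \<noteq> e' \<and> e \<inter> e' \<noteq> {} \<longrightarrow> c e \<noteq> c e')"

definition chromatic_index :: "'a graph \<Rightarrow> nat" where
  "chromatic_index G = (LEAST k. \<exists>c. proper_edge_colouring G k c)"

definition is_clique :: "'a graph \<Rightarrow> 'a set \<Rightarrow> bool" where
  "is_clique G K \<longleftrightarrow> K \<subseteq> verts G \<and> clique K (edges G)"

definition clique_number :: "'a graph \<Rightarrow> nat" where
  "clique_number G = Max (card ` {K. is_clique G K})"

definition clique_cover_number :: "'a graph \<Rightarrow> nat" where
  "clique_cover_number G =
     (LEAST k. \<exists>P. partition_on (verts G) P \<and> card P = k \<and> (\<forall>K\<in>P. is_clique G K))"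

text \<open>A cycle is given by the list of its vertices, in cyclic order.\<close>

definition is_cycle :: "'a graph \<Rightarrow> 'a list \<Rightarrow> bool" where
  "is_cycle G xs \<longleftrightarrow>
     3 \<le> length xs \<and> distinct xs \<and>
     (\<forall>i<length xs. {xs ! i, xs ! (Suc i mod length xs)} \<in> edges G)"

definition is_forest :: "'a graph \<Rightarrow> bool" where
  "is_forest G \<longleftrightarrow> (\<nexists>xs. is_cycle G xs)"

definition vertex_arboricity :: "'a graph \<Rightarrow> nat" where
  "vertex_arboricity G =
     (LEAST k. \<exists>P. partition_on (verts G) P \<and> card P = k \<and>
                   (\<forall>W\<in>P. is_forest (induced_subgraph G W)))"

definition degenerate :: "nat \<Rightarrow> 'a graph \<Rightarrow> bool" where
  "degenerate d G \<longleftrightarrow>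
     (\<forall>W. W \<subseteq> verts G \<and> W \<noteq> {} \<longrightarrow> min_degree (induced_subgraph G W) \<le> d)"

text \<open>
  The value \<open>\<emptyset>\<close> of a 1-selection is the empty set of vertices, which is never an edge;
  removing it from the edge set therefore has no effect.
\<close>

definition one_selection :: "'a graph \<Rightarrow> ('a \<Rightarrow> 'a set) \<Rightarrow> bool" where
  "one_selection G f \<longleftrightarrow>
     f \<in> verts G \<rightarrow> edges G \<union> {{}} \<and> (\<forall>v\<in>verts G. f v \<noteq> {} \<longrightarrow> v \<in> f v)"

definition one_removed :: "'a graph \<Rightarrow> ('a \<Rightarrow> 'a set) \<Rightarrow> 'a graph" where
  "one_removed G f = \<lparr>verts = verts G, edges = edges G - f ` verts G\<rparr>"

text \<open>
  The minima and maxima below are over finite nonempty sets of numbers: only finitely many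
  graphs arise as \<^term>\<open>one_removed G f\<close>, even though \<^term>\<open>f\<close> is unconstrained
  outside \<^term>\<open>verts G\<close>.
\<close>

definition chromatic_number1 :: "'a graph \<Rightarrow> nat" where
  "chromatic_number1 G = Min {chromatic_number (one_removed G f) | f. one_selection G f}"

definition clique_number1 :: "'a graph \<Rightarrow> nat" where
  "clique_number1 G = Min {clique_number (one_removed G f) | f. one_selection G f}"

definition clique_cover_number1 :: "'a graph \<Rightarrow> nat" where
  "clique_cover_number1 G = Max {clique_cover_number (one_removed G f) | f. one_selection G f}"

definition chromatic_index1 :: "'a graph \<Rightarrow> nat" where
  "chromatic_index1 G = Min {chromatic_index (one_removed G f) | f. one_selection G f}"

end

theory Submission
  imports Defs "HOL-Library.Nat_Bijection"
begin

text \<open>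
  Among the edges removed by a 1-selection, those inside a vertex set \<open>W\<close> are selected by
  vertices of \<open>W\<close>, so the removed edges form a 2-degenerate graph. It therefore splits into
  three independent sets or two induced forests, and combining such a splitting with an optimal
  structure on \<open>G\<^sub>f\<close> gives the bounds with factors \<open>3\<close> and \<open>2\<close>. Conversely a forest, and
  any graph of maximum degree at most \<open>2\<close>, can be removed completely. Hence it suffices to
  colour \<open>G\<close> with forests as classes (greedily, if \<open>G\<close> is degenerate), with classes of induced
  maximum degree \<open>2\<close> (a colouring with the fewest monochromatic edges), or, for edge colourings,
  to delete two colour classes of a colouring given by Vizing's theorem.

  Most extremal examples are complete graphs. The bound \<open>\<chi>\<^sub>1 \<le> \<chi>\<close> is attained by complete
  multipartite graphs with large classes, and the degeneracy bound by finite parts of a universal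
  graph in which every small vertex set has many common later neighbours.
\<close>

section \<open>Kempe chains and Vizing's theorem\<close>

text \<open>A selection removes at most |W| edges inside W, so the removed edges have average degree
  at most 2 there; the factors 2 and 3 both come from this count. Greedy distribution of a
  d-degenerate graph over q classes, where each new vertex sends at most t edges into its class,
  works whenever d < q * (t + 1). For d = 2, taking t = 0 gives three independent sets and t = 1
  gives two forests; for general d, t = 1 gives d div 2 + 1 forests. The bound Delta - 1 needs the
  full strength of Vizing's theorem, because two colours are subtracted from Delta + 1. In the
  examples the difficulty is that the selection is arbitrary. Complete graphs are settled by
  squeezing omega_1 <= chi_1 between two bounds. In the multipartite graphs there are more
  edge-disjoint k-cliques than edges that can be removed. In the degenerate graphs a vertex with two
  earlier neighbours of its own colour can select only one of the two edges, and each earlier vertex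
  can make up for only one such deficit.\<close>

text \<open>
  A colour class of a proper edge colouring is a matching, represented by the involution that
  swaps the ends of its edges and fixes the uncovered vertices. A vertex misses a colour iff it
  is a fixed point of that involution, and recolouring becomes a function update. The Kempe chain
  of a fixed point \<open>u\<close> is its orbit under two involutions: a walk which can only turn round at a
  further fixed point, so that it contains at most one more of them.
\<close>

lemma involution_chain_from_end:
  fixes A B :: "'a \<Rightarrow> 'a"
  assumes A: "\<And>v. A (A v) = v" and B: "\<And>v. B (B v) = v"
    and u: "A u = u" and x: "A x = x \<or> B x = x" and w: "A w = w \<or> B w = w"
    and dist: "x \<noteq> u" "w \<noteq> u" "x \<noteq> w"
  shows "\<exists>K. (\<forall>v\<in>K. A v \<in> K \<and> B v \<in> K) \<and> u \<in> K \<and> \<not> (x \<in> K \<and> w \<in> K)"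
proof -
  define g where "g = (\<lambda>n::nat. if even n then B else A)"
  define s where "s = rec_nat u (\<lambda>n v. g n v)"
  have s0: "s 0 = u" and sS: "\<And>n. s (Suc n) = g n (s n)"
    by (simp_all add: s_def)
  have gg: "g n (g n v) = v" for n v
    using A B by (simp add: g_def)
  have retreat: "g n (s (Suc n)) = s n" for n
    by (simp add: sS gg)
  \<comment> \<open>At position \<open>t\<close> one involution is the next step of the walk and the
    other undoes the last step; at \<open>t = 0\<close> the other one is \<open>A\<close>, which
    fixes \<open>u\<close>.\<close>
  have AB: "h = g t \<or> (t = 0 \<and> h = A) \<or> (\<exists>r. t = Suc r \<and> h = g r)" if "h = A \<or> h = B" for h t
    using that by (cases t) (auto simp: g_def)
  have closed: "h (s t) \<in> {s t, s (Suc t), s (t - 1)}" if "h = A \<or> h = B" for h t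
    using AB[OF that, of t] by (auto simp: sS[symmetric] s0 u retreat)
  \<comment> \<open>After a stall at \<open>i\<close> the walk retraces its steps, so no new vertex
    ever appears.\<close>
  have bounce: "s n \<in> s ` {..i}" if i: "s (Suc i) = s i" for i n
  proof (induction n)
    case 0
    then show ?case by auto
  next
    case (Suc n)
    then obtain t where t: "t \<le> i" "s n = s t" by auto
    have "g n = A \<or> g n = B" by (simp add: g_def)
    from closed[OF this, of t] have "s (Suc n) \<in> {s t, s (Suc t), s (t - 1)}"
      using t by (simp add: sS)
    moreover have "s (Suc t) \<in> s ` {..i}"
      using t i by (cases "t = i") auto
    moreover have "s t \<in> s ` {..i}" "s (t - 1) \<in> s ` {..i}"
      using t by auto
    ultimately show ?case by auto
  qed
  \<comment> \<open>The first visit to \<open>v\<close> arrives through an involution that moves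
    \<open>v\<close>. The one fixing \<open>v\<close> is therefore the next to be applied, and the
    walk stalls.\<close>
  have first: "s (Suc (LEAST n. s n = v)) = v \<and> s (LEAST n. s n = v) = v"
    if v: "v \<in> range s" "A v = v \<or> B v = v" "v \<noteq> u" for v
  proof -
    define i where "i = (LEAST n. s n = v)"
    have si: "s i = v" unfolding i_def using v(1) by (metis (mono_tags) LeastI rangeE)
    then obtain r where r: "i = Suc r" using s0 v(3) by (cases i) auto
    have "s r \<noteq> v" using not_less_Least[of r "\<lambda>n. s n = v"] r i_def by auto
    then have "g r v \<noteq> v" using retreat[of r] si r by auto
    then have "g i v = v" using v(2) r by (auto simp: g_def split: if_splits)
    then show ?thesis using si sS[of i] unfolding i_def[symmetric] by simp
  qed
  have "\<not> (x \<in> range s \<and> w \<in> range s)"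
  proof
    assume *: "x \<in> range s \<and> w \<in> range s"
    \<comment> \<open>The walk turns round at its first visit to \<open>a\<close>, so whatever it
      reaches was met by then. Used in both directions, this makes the first visits to
      \<open>x\<close> and \<open>w\<close> coincide.\<close>
    have le: "(LEAST n. s n = b) \<le> (LEAST n. s n = a)"
      if "a \<in> range s" "A a = a \<or> B a = a" "a \<noteq> u" "b \<in> range s" for a b
    proof -
      note first_a = first[OF that(1-3)]
      from that(4) obtain n where n: "b = s n" by blast
      then obtain t where "t \<le> (LEAST n. s n = a)" "s t = b"
        using bounce[of "LEAST n. s n = a" n] first_a n by force
      then show ?thesis using Least_le[of "\<lambda>n. s n = b" t] by simp
    qed
    have "(LEAST n. s n = x) = (LEAST n. s n = w)"
      using le[of x w] le[of w x] * x w dist by auto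
    then show False using first[of x] first[of w] * x w dist by metis
  qed
  moreover have "\<forall>v\<in>range s. A v \<in> range s \<and> B v \<in> range s"
    using closed by blast
  moreover have "u \<in> range s" using s0 by (metis rangeI)
  ultimately show ?thesis by blast
qed

text \<open>At most one of \<open>x\<close> and \<open>w\<close> lies on the chain of
  \<open>u\<close>. If \<open>x\<close> does, the complement of the chain serves instead: it is
  closed too, and it contains \<open>w\<close>.\<close>

lemma involution_chain_avoiding:
  fixes A B :: "'a \<Rightarrow> 'a"
  assumes A: "\<And>v. A (A v) = v" and B: "\<And>v. B (B v) = v"
    and ends: "A u = u \<or> B u = u" "A x = x \<or> B x = x" "A w = w \<or> B w = w"
    and dist: "x \<noteq> u" "w \<noteq> u" "x \<noteq> w"
  shows "\<exists>K. (\<forall>v\<in>K. A v \<in> K \<and> B v \<in> K) \<and> x \<notin> K \<and> (u \<in> K \<or> w \<in> K)"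
proof -
  obtain K where K: "\<forall>v\<in>K. A v \<in> K \<and> B v \<in> K" "u \<in> K" "\<not> (x \<in> K \<and> w \<in> K)"
    using ends(1)
  proof
    assume "A u = u"
    from involution_chain_from_end[of A B, OF A B this ends(2,3) dist] show ?thesis
      using that by blast
  next
    assume "B u = u"
    from involution_chain_from_end[of B A u x w, OF B A this] show ?thesis
      using that ends(2,3) dist by blast
  qed
  have "\<forall>v\<in>-K. A v \<in> -K \<and> B v \<in> -K"
    using K(1) A B by (metis ComplD ComplI)
  then show ?thesis
    using K by (cases "x \<in> K") blast+
qed

section \<open>Partial edge colourings, fans and Vizing's recolouring step\<close>

definition matching_family :: "'a set set \<Rightarrow> nat \<Rightarrow> (nat \<Rightarrow> 'a \<Rightarrow> 'a) \<Rightarrow> bool" where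
  "matching_family E k M \<longleftrightarrow>
     (\<forall>i<k. \<forall>v. M i (M i v) = v \<and> (M i v \<noteq> v \<longrightarrow> {v, M i v} \<in> E)) \<and>
     (\<forall>i<k. \<forall>j<k. \<forall>v. M i v = M j v \<longrightarrow> M i v \<noteq> v \<longrightarrow> i = j)"

text \<open>Kept apart from \<open>matching_family\<close> because colourings may be partial:
  \<open>covers\<close> is also applied to \<open>E\<close> without its one edge that still awaits a
  colour.\<close>

definition covers :: "'a set set \<Rightarrow> nat \<Rightarrow> (nat \<Rightarrow> 'a \<Rightarrow> 'a) \<Rightarrow> bool" where
  "covers E k M \<longleftrightarrow> (\<forall>u v. {u, v} \<in> E \<longrightarrow> u \<noteq> v \<longrightarrow> (\<exists>i<k. M i u = v))"

text \<open>
  \<open>(p, q)\<close> is in the fan relation at \<open>x\<close> if the colour of the edge \<open>xq\<close> is missing at \<open>p\<close>, so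
  that it can be moved to an uncoloured edge \<open>xp\<close>.
\<close>

definition fan :: "nat \<Rightarrow> (nat \<Rightarrow> 'a \<Rightarrow> 'a) \<Rightarrow> 'a \<Rightarrow> ('a \<times> 'a) set" where
  "fan k M x = {(p, q). q \<noteq> x \<and> (\<exists>i<k. M i x = q \<and> M i p = p)}"

lemma matching_familyD:
  assumes "matching_family E k M" "i < k"
  shows "M i (M i v) = v" "M i v \<noteq> v \<Longrightarrow> {v, M i v} \<in> E"
    "j < k \<Longrightarrow> M i v = M j v \<Longrightarrow> M i v \<noteq> v \<Longrightarrow> i = j"
  using assms unfolding matching_family_def by blast+

lemma matching_family_update:
  assumes "matching_family E k M" "c < k"
    and "\<And>v. N (N v) = v" "\<And>v. N v \<noteq> v \<Longrightarrow> {v, N v} \<in> E"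
    and "\<And>i v. i < k \<Longrightarrow> i \<noteq> c \<Longrightarrow> N v \<noteq> v \<Longrightarrow> M i v \<noteq> N v"
  shows "matching_family E k (M(c := N))"
proof -
  note mf = matching_familyD[OF assms(1)]
  have "i = j" if "i < k" "j < k" "(M(c := N)) i v = (M(c := N)) j v" "(M(c := N)) i v \<noteq> v"
    for i j v
  proof (cases "i = c \<or> j = c")
    case True
    then show ?thesis using that assms(5)[of i v] assms(5)[of j v]
      by (metis fun_upd_other fun_upd_same)
  next
    case False
    then show ?thesis using that mf(3)[of i j v] by simp
  qed
  then show ?thesis
    using mf(1,2) assms(3,4) unfolding matching_family_def by (simp add: fun_upd_apply)
qed

text \<open>A walk can be restarted at its last visit to \<open>y\<close>, so only the steps into
  other vertices have to survive in \<open>S\<close>.\<close>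

lemma relpow_no_return:
  assumes "\<And>p q. (p, q) \<in> R \<Longrightarrow> q \<noteq> y \<Longrightarrow> (p, q) \<in> S"
  shows "(y, z) \<in> R ^^ n \<Longrightarrow> \<exists>m\<le>n. (y, z) \<in> S ^^ m"
proof (induction n arbitrary: z)
  case 0
  then show ?case by auto
next
  case (Suc n)
  then obtain p where p: "(y, p) \<in> R ^^ n" "(p, z) \<in> R" by auto
  show ?case
  proof (cases "z = y")
    case True
    then show ?thesis by (intro exI[of _ 0]) auto
  next
    case False
    from Suc.IH[OF p(1)] obtain m where "m \<le> n" "(y, p) \<in> S ^^ m"
      by blast
    then show ?thesis using assms[OF p(2) False] by (intro exI[of _ "Suc m"]) auto
  qed
qed

text \<open>The uncoloured edge \<open>xy\<close> takes over the colour of the next fan edge, which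
  becomes the uncoloured one, until the colour \<open>c\<close> missing at both ends can be used.
  The fan is any walk, possibly with repetitions; cutting out returns may shorten it by more than
  one step, hence the strong induction.\<close>

lemma fan_rotation:
  assumes "(y, z) \<in> fan k M x ^^ n" "matching_family E k M" "{x, y} \<in> E" "x \<noteq> y"
    "covers (E - {{x, y}}) k M" "\<forall>i<k. M i x \<noteq> y" "c < k" "M c x = x" "M c z = z"
  shows "\<exists>M'. matching_family E k M' \<and> covers E k M'"
  using assms
proof (induction n arbitrary: y M rule: less_induct)
  case (less n)
  note mf = matching_familyD[OF less.prems(2)]
  note xy = less.prems(3,4) and cov = less.prems(5) and unc = less.prems(6) and c = less.prems(7-9)
  show ?case
  proof (cases n)
    case 0
    then have yz: "y = z" using less.prems by auto
    define M' where "M' = M(c := (M c)(x := y, y := x))"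
    have inv: "M c v \<noteq> x" "M c v \<noteq> y" if "v \<noteq> x" "v \<noteq> y" for v
      using that mf(1)[OF \<open>c < k\<close>, of v] c yz by metis+
    have "matching_family E k M'"
      unfolding M'_def
    proof (rule matching_family_update[OF less.prems(2) \<open>c < k\<close>])
      fix v
      show "((M c)(x := y, y := x)) (((M c)(x := y, y := x)) v) = v"
        using mf(1)[OF \<open>c < k\<close>] inv[of v] xy by auto
      show "{v, ((M c)(x := y, y := x)) v} \<in> E" if "((M c)(x := y, y := x)) v \<noteq> v"
        using that mf(2)[OF \<open>c < k\<close>, of v] xy
        by (auto simp: insert_commute split: if_splits)
      show "M i v \<noteq> ((M c)(x := y, y := x)) v"
        if "i < k" "i \<noteq> c" "((M c)(x := y, y := x)) v \<noteq> v" for i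
        using that mf(1)[OF that(1), of v] mf(3)[OF that(1) \<open>c < k\<close>, of v] unc xy(2)
        by (auto split: if_splits)
    qed
    moreover have "covers E k M'"
      unfolding covers_def
    proof (intro allI impI)
      fix u v assume uv: "{u, v} \<in> E" "u \<noteq> v"
      show "\<exists>i<k. M' i u = v"
      proof (cases "{u, v} = {x, y}")
        case True
        then show ?thesis using \<open>c < k\<close> uv by (intro exI[of _ c]) (auto simp: M'_def doubleton_eq_iff)
      next
        case False
        then obtain i where i: "i < k" "M i u = v"
          using cov uv unfolding covers_def by blast
        have "M' i u = v" using i uv c yz False by (auto simp: M'_def)
        then show ?thesis using i by blast
      qed
    qed
    ultimately show ?thesis by blast
  next
    case (Suc r)
    then obtain y1 where y1: "(y, y1) \<in> fan k M x" "(y1, z) \<in> fan k M x ^^ r"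
      using less.prems(1) by (metis relpow_Suc_D2)
    then obtain j where j: "j < k" "M j x = y1" "M j y = y" "y1 \<noteq> x"
      by (auto simp: fan_def)
    have y1y: "y1 \<noteq> y" using unc j by auto
    have jy1: "M j y1 = x" using mf(1)[OF j(1), of x] j by simp
    \<comment> \<open>Colour \<open>j\<close> moves from \<open>{x, y1}\<close> to
      \<open>{x, y}\<close>; since \<open>j\<close> was missing at \<open>y\<close>, only
      \<open>y1\<close> becomes uncovered.\<close>
    define M' where "M' = M(j := (M j)(x := y, y := x, y1 := y1))"
    have inv: "M j v \<noteq> x" "M j v \<noteq> y" "M j v \<noteq> y1" if "v \<noteq> x" "v \<noteq> y" "v \<noteq> y1" for v
      using that mf(1)[OF j(1), of v] j jy1 by metis+
    have E1: "{x, y1} \<in> E" using mf(2)[OF j(1), of x] j by simp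
    have M': "matching_family E k M'"
      unfolding M'_def
    proof (rule matching_family_update[OF less.prems(2) j(1)])
      fix v
      let ?N = "(M j)(x := y, y := x, y1 := y1)"
      show "?N (?N v) = v"
        using mf(1)[OF j(1)] inv[of v] xy y1y j by auto
      show "{v, ?N v} \<in> E" if "?N v \<noteq> v"
        using that mf(2)[OF j(1), of v] xy
        by (auto simp: insert_commute split: if_splits)
      show "M i v \<noteq> ?N v" if "i < k" "i \<noteq> j" "?N v \<noteq> v" for i
        using that mf(1)[OF that(1), of v] mf(3)[OF that(1) j(1), of v] unc xy(2)
        by (auto split: if_splits)
    qed
    have cov': "covers (E - {{x, y1}}) k M'"
      unfolding covers_def
    proof (intro allI impI)
      fix u v assume uv: "{u, v} \<in> E - {{x, y1}}" "u \<noteq> v"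
      show "\<exists>i<k. M' i u = v"
      proof (cases "{u, v} = {x, y}")
        case True
        then show ?thesis using j uv y1y by (intro exI[of _ j]) (auto simp: M'_def doubleton_eq_iff)
      next
        case False
        then obtain i where i: "i < k" "M i u = v"
          using cov uv unfolding covers_def by blast
        have "M' i u = v" using i uv j jy1 y1y False by (auto simp: M'_def doubleton_eq_iff)
        then show ?thesis using i by blast
      qed
    qed
    have not: "\<forall>i<k. M' i x \<noteq> y1"
    proof (intro allI impI)
      fix i assume "i < k"
      show "M' i x \<noteq> y1"
        using mf(3)[OF \<open>i < k\<close> j(1), of x] j y1y by (cases "i = j") (auto simp: M'_def)
    qed
    \<comment> \<open>Only steps into \<open>y1\<close> use colour \<open>j\<close> at
      \<open>x\<close>; all others keep their colour class unchanged.\<close>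
    have "(p, q) \<in> fan k M' x" if pq: "(p, q) \<in> fan k M x" "q \<noteq> y1" for p q
    proof -
      obtain i where i: "i < k" "M i x = q" "M i p = p" "q \<noteq> x" using pq by (auto simp: fan_def)
      then have "i \<noteq> j" using j \<open>q \<noteq> y1\<close> by auto
      then show ?thesis using i by (auto simp: fan_def M'_def)
    qed
    from relpow_no_return[OF this y1(2)] obtain m where m: "m \<le> r" "(y1, z) \<in> fan k M' x ^^ m"
      by blast
    have "c \<noteq> j" using j c by auto
    then have "M' c x = x" "M' c z = z" using c by (auto simp: M'_def)
    then show ?thesis
      using less.IH[OF _ m(2) M' E1 _ cov' not \<open>c < k\<close>] m(1) Suc j(4) by auto
  qed
qed

text \<open>No edge of colour \<open>c\<close> or \<open>d\<close> joins \<open>K\<close> to its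
  complement, so the exchange is consistent at both ends of each edge, and a coloured edge stays
  coloured.\<close>

lemma kempe_swap:
  assumes M: "matching_family E k M" and "c < k" "d < k"
    and K: "\<forall>v\<in>K. M c v \<in> K \<and> M d v \<in> K"
  defines "M' \<equiv> (\<lambda>i v. if v \<in> K then M (if i = c then d else if i = d then c else i) v else M i v)"
  shows "matching_family E k M'" "covers F k M \<Longrightarrow> covers F k M'"
proof -
  note mf = matching_familyD[OF M]
  define t where "t i = (if i = c then d else if i = d then c else i)" for i
  have tt: "t (t i) = i" for i by (auto simp: t_def)
  have tk: "i < k \<Longrightarrow> t i < k" for i using assms by (auto simp: t_def)
  have M't: "M' = (\<lambda>i v. if v \<in> K then M (t i) v else M i v)"
    unfolding M'_def t_def ..
  have nK: "M c v \<notin> K" "M d v \<notin> K" if "v \<notin> K" for v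
    using that K mf(1) \<open>c < k\<close> \<open>d < k\<close> by metis+
  have other: "M' i v = M i v" if "i \<noteq> c" "i \<noteq> d" for i v
    using that by (simp add: M'_def)
  have "M' i (M' i v) = v" if "i < k" for i v
  proof (cases "i = c \<or> i = d")
    case True
    then show ?thesis using nK[of v] K mf(1)[OF \<open>i < k\<close>] mf(1)[OF tk[OF \<open>i < k\<close>]]
      by (cases "v \<in> K") (auto simp: M't t_def)
  next
    case False
    then show ?thesis using mf(1)[OF that] other by auto
  qed
  moreover have "M' i v \<noteq> v \<Longrightarrow> {v, M' i v} \<in> E" if "i < k" for i v
    using mf(2) that tk by (auto simp: M't)
  moreover have "i = j" if "i < k" "j < k" "M' i v = M' j v" "M' i v \<noteq> v" for i j v
    using that mf(3)[of i j v] mf(3)[of "t i" "t j" v] tk tt unfolding M't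
    by (metis (full_types))
  ultimately show "matching_family E k M'"
    unfolding matching_family_def by blast
  show "covers F k M'" if F: "covers F k M"
    unfolding covers_def
  proof (intro allI impI)
    fix u v assume "{u, v} \<in> F" "u \<noteq> v"
    then obtain i where i: "i < k" "M i u = v" using F unfolding covers_def by blast
    then show "\<exists>i<k. M' i u = v"
      using tk tt by (intro exI[of _ "if u \<in> K then t i else i"]) (auto simp: M't)
  qed
qed

lemma matching_family_missing:
  assumes M: "matching_family E k M" and "finite E" "card {e \<in> E. v \<in> e} < k"
  shows "\<exists>i<k. M i v = v"
proof (rule ccontr)
  assume "\<not> ?thesis"
  then have n: "M i v \<noteq> v" if "i < k" for i using that by blast
  have "inj_on (\<lambda>i. {v, M i v}) {..<k}"
    using matching_familyD(3)[OF M] n by (auto simp: inj_on_def doubleton_eq_iff)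
  moreover have "(\<lambda>i. {v, M i v}) ` {..<k} \<subseteq> {e \<in> E. v \<in> e}"
    using matching_familyD(2)[OF M] n by auto
  ultimately have "k \<le> card {e \<in> E. v \<in> e}"
    using card_inj_on_le[of "\<lambda>i. {v, M i v}" "{..<k}"] \<open>finite E\<close> by auto
  then show False using assms by simp
qed

text \<open>If some vertex reachable in the fan shares its chosen missing colour with
  \<open>x\<close>, rotating the fan up to it suffices. Otherwise two fan vertices miss a common
  colour \<open>d\<close>. Swapping \<open>d\<close> with a colour \<open>c\<close> missing at
  \<open>x\<close>, along a chain that avoids \<open>x\<close>, creates a fan vertex missing
  \<open>c\<close>, and rotation applies again.\<close>

lemma vizing_step:
  assumes M: "matching_family E k M" and "finite E" "\<And>v. card {e \<in> E. v \<in> e} < k"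
    and e: "{x, y} \<in> E" "x \<noteq> y" and cov: "covers (E - {{x, y}}) k M"
  shows "\<exists>M'. matching_family E k M' \<and> covers E k M'"
proof (cases "\<exists>i<k. M i x = y")
  case True
  then obtain i where i: "i < k" "M i x = y" by blast
  then have "M i y = x" using matching_familyD(1)[OF M, of i x] by simp
  then have "covers E k M"
    using cov i unfolding covers_def by (metis Diff_iff doubleton_eq_iff singletonD)
  then show ?thesis using M by blast
next
  case False
  then have unc: "\<forall>i<k. M i x \<noteq> y" by blast
  note rot = fan_rotation[OF _ M e cov unc]
  define R where "R = (fan k M x)\<^sup>* `` {y}"
  note missing = matching_family_missing[OF M \<open>finite E\<close> assms(3)]
  obtain c where c: "c < k" "M c x = x" using missing by blast
  from missing obtain m where m: "\<And>v. m v < k" "\<And>v. M (m v) v = v" by metis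
  show ?thesis
  proof (cases "\<exists>z\<in>R. M (m z) x = x")
    case True
    then show ?thesis using rot m unfolding R_def by (metis Image_singleton_iff rtrancl_imp_relpow)
  next
    case False
    then have nx: "\<And>z. z \<in> R \<Longrightarrow> M (m z) x \<noteq> x" by blast
    have xR: "x \<notin> R" unfolding R_def
      using e by (auto elim: rtranclE simp: fan_def)
    have fin: "finite R"
    proof -
      have "R \<subseteq> insert y ((\<lambda>i. M i x) ` {..<k})"
        unfolding R_def by (auto elim: rtranclE simp: fan_def)
      then show ?thesis using finite_subset by blast
    qed
    have step: "M (m z) x \<in> R - {y}" if "z \<in> R" for z
    proof -
      have "(z, M (m z) x) \<in> fan k M x" using nx[OF that] m by (auto simp: fan_def)
      then have "M (m z) x \<in> R" using that unfolding R_def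
        by (auto intro: rtrancl.rtrancl_into_rtrancl)
      then show ?thesis using unc m by auto
    qed
    have "y \<in> R" by (simp add: R_def)
    \<comment> \<open>The edge \<open>xy\<close> is uncoloured, so \<open>z \<mapsto> M (m z) x\<close> maps \<open>R\<close> into \<open>R - {y}\<close>: two vertices of
      the fan miss the same colour.\<close>
    have "\<not> inj_on (\<lambda>z. M (m z) x) R"
    proof
      assume "inj_on (\<lambda>z. M (m z) x) R"
      then have "card R \<le> card (R - {y})"
        using card_inj_on_le[of _ R "R - {y}"] step fin by blast
      then show False using fin \<open>y \<in> R\<close> card_gt_0_iff[of R] by (auto simp: card_Diff_singleton)
    qed
    then obtain u w where uw: "u \<in> R" "w \<in> R" "u \<noteq> w" "M (m u) x = M (m w) x"
      unfolding inj_on_def by blast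
    define d where "d = m u"
    have d: "d < k" "M d u = u" "M d w = w"
      using m[of u] m[of w] matching_familyD(3)[OF M, of "m u" "m w" x] uw nx
      unfolding d_def by auto
    \<comment> \<open>All three of \<open>x\<close>, \<open>u\<close>, \<open>w\<close> are ends of
      chains in the colours \<open>c\<close> and \<open>d\<close>. Avoiding \<open>x\<close> keeps
      \<open>c\<close> missing at \<open>x\<close> and the colours of the fan edges intact.\<close>
    obtain K where K: "\<forall>v\<in>K. M c v \<in> K \<and> M d v \<in> K" "x \<notin> K" "u \<in> K \<or> w \<in> K"
      using involution_chain_avoiding[of "M c" "M d" u x w]
        matching_familyD(1)[OF M] c d uw xR by metis
    define M' where
      "M' = (\<lambda>i v. if v \<in> K then M (if i = c then d else if i = d then c else i) v else M i v)"
    note M' = kempe_swap[OF M c(1) d(1) K(1), folded M'_def]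
    have M'x: "M' i x = M i x" for i using K by (simp add: M'_def)
    \<comment> \<open>The swap destroys a step out of \<open>p\<close> only if \<open>p \<in> K\<close> missed \<open>d\<close>; such a \<open>p\<close> now misses \<open>c\<close>
      and can end the fan itself.\<close>
    have reach: "(y, z) \<in> (fan k M' x)\<^sup>* \<or> (\<exists>p\<in>K. M d p = p \<and> (y, p) \<in> (fan k M' x)\<^sup>*)"
      if "(y, z) \<in> (fan k M x)\<^sup>*" for z
      using that
    proof induction
      case base
      then show ?case by simp
    next
      case (step p q)
      from step.hyps obtain i where i: "i < k" "M i x = q" "M i p = p" "q \<noteq> x"
        by (auto simp: fan_def)
      have "i \<noteq> c" using i c by auto
      show ?case
      proof (cases "p \<in> K \<and> i = d")
        case True
        then show ?thesis using step.IH i by blast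
      next
        case False
        then have "M' i p = p" using i \<open>i \<noteq> c\<close> by (auto simp: M'_def)
        then have "(p, q) \<in> fan k M' x" using i M'x by (auto simp: fan_def)
        then show ?thesis using step.IH by (meson rtrancl.rtrancl_into_rtrancl)
      qed
    qed
    obtain p where p: "p \<in> K" "M d p = p" "(y, p) \<in> (fan k M' x)\<^sup>*"
      using K(3) reach[of u] reach[of w] uw d unfolding R_def by blast
    have "M' c p = p" "M' c x = x" using p c K by (auto simp: M'_def)
    then show ?thesis
      using fan_rotation[OF _ M'(1) e M'(2)[OF cov]] unc M'x c p(3)
      by (metis rtrancl_imp_relpow)
  qed
qed

lemma vizing_matching_family:
  assumes "finite E" "\<And>e. e \<in> E \<Longrightarrow> card e = 2" "\<And>v. card {e \<in> E. v \<in> e} < k"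
  shows "\<exists>M. matching_family E k M \<and> covers E k M"
  using assms
proof (induction E rule: finite_induct)
  case empty
  then show ?case
    by (intro exI[of _ "\<lambda>i v. v"]) (simp add: matching_family_def covers_def)
next
  case (insert e E)
  have "card {e' \<in> E. v \<in> e'} \<le> card {e' \<in> insert e E. v \<in> e'}" for v
    using insert.hyps by (intro card_mono) auto
  then obtain M where M: "matching_family E k M" "covers E k M"
    using insert.IH insert.prems by (meson insertCI le_less_trans)
  obtain x y where xy: "e = {x, y}" "x \<noteq> y"
    using insert.prems(1)[of e] by (auto simp: card_2_iff)
  have "matching_family (insert e E) k M"
    using M(1) unfolding matching_family_def by auto
  moreover have "covers (insert e E - {{x, y}}) k M"
    using M(2) xy unfolding covers_def by blast
  ultimately show ?case
    using vizing_step[of "insert e E" k M x y] insert.prems(2) insert.hyps xy by auto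
qed

section \<open>Graph parameters and 1-selections\<close>

lemma finite_edges:
  assumes "simple_graph G" shows "finite (edges G)"
  using assms unfolding simple_graph_def
  by (meson finite_imp_finite_nsets finite_subset)

lemma card_edge: "simple_graph G \<Longrightarrow> e \<in> edges G \<Longrightarrow> card e = 2"
  unfolding simple_graph_def nsets_def by blast

lemma edge_subset_verts: "simple_graph G \<Longrightarrow> e \<in> edges G \<Longrightarrow> e \<subseteq> verts G"
  unfolding simple_graph_def nsets_def by blast

lemma edge_endpoints:
  assumes "simple_graph G" "{u, v} \<in> edges G"
  shows "u \<noteq> v" "u \<in> verts G" "v \<in> verts G"
  using card_edge[OF assms] edge_subset_verts[OF assms] by auto

lemma edgeE:
  assumes "simple_graph G" "e \<in> edges G"
  obtains u v where "e = {u, v}" "u \<noteq> v" "u \<in> verts G" "v \<in> verts G"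
  using card_edge[OF assms] edge_subset_verts[OF assms] by (auto simp: card_2_iff)

lemma edge_other_end:
  assumes "simple_graph G" "e \<in> edges G" "v \<in> e"
  obtains u where "e = {v, u}" "u \<noteq> v" "u \<in> verts G"
  using assms by (elim edgeE) (auto simp: insert_commute)

lemma simple_graph_one_removed: "simple_graph G \<Longrightarrow> simple_graph (one_removed G f)"
  unfolding simple_graph_def one_removed_def by auto

lemma verts_one_removed [simp]: "verts (one_removed G f) = verts G"
  and edges_one_removed [simp]: "edges (one_removed G f) = edges G - f ` verts G"
  by (simp_all add: one_removed_def)

lemma one_selection_empty: "one_selection G (\<lambda>_. {})"
  by (simp add: one_selection_def)

lemma one_removed_empty:
  assumes "simple_graph G" shows "one_removed G (\<lambda>_. {}) = G"
proof -
  have "{} \<notin> edges G" using card_edge[OF assms] by fastforce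
  then have "edges G - (\<lambda>_. {}) ` verts G = edges G" by blast
  then show ?thesis by (simp add: one_removed_def)
qed

lemma finite_one_removed_values:
  assumes "simple_graph G"
  shows "finite {P (one_removed G f) | f. one_selection G f}"
proof -
  have "{P (one_removed G f) | f. one_selection G f}
      \<subseteq> P ` (\<lambda>E. \<lparr>verts = verts G, edges = E\<rparr>) ` Pow (edges G)"
    by (auto simp: one_removed_def)
  then show ?thesis using finite_edges[OF assms] by (meson finite_Pow_iff finite_imageI finite_subset)
qed

lemma one_removed_values_nonempty: "{P (one_removed G f) | f. one_selection G f} \<noteq> {}"
  using one_selection_empty by blast

lemma chromatic_number1_le:
  "simple_graph G \<Longrightarrow> one_selection G f \<Longrightarrow> chromatic_number1 G \<le> chromatic_number (one_removed G f)"
  unfolding chromatic_number1_def by (rule Min_le[OF finite_one_removed_values]) auto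

lemma clique_number1_le:
  "simple_graph G \<Longrightarrow> one_selection G f \<Longrightarrow> clique_number1 G \<le> clique_number (one_removed G f)"
  unfolding clique_number1_def by (rule Min_le[OF finite_one_removed_values]) auto

lemma chromatic_index1_le:
  "simple_graph G \<Longrightarrow> one_selection G f \<Longrightarrow> chromatic_index1 G \<le> chromatic_index (one_removed G f)"
  unfolding chromatic_index1_def by (rule Min_le[OF finite_one_removed_values]) auto

lemma clique_cover_number1_ge:
  "simple_graph G \<Longrightarrow> one_selection G f \<Longrightarrow> clique_cover_number (one_removed G f) \<le> clique_cover_number1 G"
  unfolding clique_cover_number1_def by (rule Max_ge[OF finite_one_removed_values]) auto

lemma chromatic_number1E:
  assumes "simple_graph G"
  obtains f where "one_selection G f" "chromatic_number1 G = chromatic_number (one_removed G f)"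
  using Min_in[OF finite_one_removed_values[OF assms, of chromatic_number]
      one_removed_values_nonempty] unfolding chromatic_number1_def by auto

lemma clique_number1E:
  assumes "simple_graph G"
  obtains f where "one_selection G f" "clique_number1 G = clique_number (one_removed G f)"
  using Min_in[OF finite_one_removed_values[OF assms, of clique_number]
      one_removed_values_nonempty] unfolding clique_number1_def by auto

lemma chromatic_index1E:
  assumes "simple_graph G"
  obtains f where "one_selection G f" "chromatic_index1 G = chromatic_index (one_removed G f)"
  using Min_in[OF finite_one_removed_values[OF assms, of chromatic_index]
      one_removed_values_nonempty] unfolding chromatic_index1_def by auto

lemma clique_cover_number1E:
  assumes "simple_graph G"
  obtains f where "one_selection G f" "clique_cover_number1 G = clique_cover_number (one_removed G f)"
  using Max_in[OF finite_one_removed_values[OF assms, of clique_cover_number]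
      one_removed_values_nonempty] unfolding clique_cover_number1_def by auto

section \<open>Minimum colourings and partitions\<close>

lemma proper_colouring_mono: "proper_colouring G k c \<Longrightarrow> k \<le> l \<Longrightarrow> proper_colouring G l c"
  unfolding proper_colouring_def by (auto simp: Pi_iff intro: less_le_trans)

text \<open>An injective numbering of the vertices shows that the \<open>LEAST\<close> is
  attained.\<close>

lemma chromatic_number_le_iff:
  assumes "simple_graph G"
  shows "chromatic_number G \<le> k \<longleftrightarrow> (\<exists>c. proper_colouring G k c)"
proof
  have "finite (verts G)" using assms by (simp add: simple_graph_def)
  then obtain c :: "'a \<Rightarrow> nat" and n where c: "inj_on c (verts G)" "c ` verts G = {..<n}"
    using finite_imp_inj_to_nat_seg by (metis lessThan_def)
  have "proper_colouring G n c"
    unfolding proper_colouring_def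
  proof (intro conjI allI impI)
    show "c \<in> verts G \<rightarrow> {..<n}" using c by blast
    show "c u \<noteq> c v" if "{u, v} \<in> edges G" for u v
      using edge_endpoints[OF assms that] c(1) by (metis inj_onD)
  qed
  then have "\<exists>n c. proper_colouring G n c" by blast
  from LeastI_ex[OF this] obtain c where "proper_colouring G (chromatic_number G) c"
    unfolding chromatic_number_def by blast
  moreover assume "chromatic_number G \<le> k"
  ultimately show "\<exists>c. proper_colouring G k c" using proper_colouring_mono by blast
next
  assume "\<exists>c. proper_colouring G k c"
  then show "chromatic_number G \<le> k" unfolding chromatic_number_def by (rule Least_le)
qed

text \<open>A bound on \<open>chromatic_number1\<close> amounts to a colouring, not necessarily
  proper, whose monochromatic edges can all be selected. This rule and the elimination rule below
  hide \<open>one_removed\<close>.\<close>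

lemma chromatic_number1_leI:
  assumes "simple_graph G" "one_selection G f" "c \<in> verts G \<rightarrow> {..<k}"
    and "\<And>u v. {u, v} \<in> edges G \<Longrightarrow> c u = c v \<Longrightarrow> {u, v} \<in> f ` verts G"
  shows "chromatic_number1 G \<le> k"
proof -
  have "proper_colouring (one_removed G f) k c"
    using assms(3,4) by (auto simp: proper_colouring_def)
  then have "chromatic_number (one_removed G f) \<le> k"
    using chromatic_number_le_iff[OF simple_graph_one_removed[OF assms(1)]] by blast
  then show ?thesis using chromatic_number1_le[OF assms(1,2)] by simp
qed

lemma chromatic_number1_leE:
  assumes "simple_graph G" "chromatic_number1 G \<le> k"
  obtains f c where "one_selection G f" "c \<in> verts G \<rightarrow> {..<k}"
    "\<And>u v. {u, v} \<in> edges G \<Longrightarrow> c u = c v \<Longrightarrow> {u, v} \<in> f ` verts G"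
proof -
  obtain f where f: "one_selection G f" "chromatic_number1 G = chromatic_number (one_removed G f)"
    using chromatic_number1E[OF assms(1)] .
  then obtain c where c: "proper_colouring (one_removed G f) k c"
    using chromatic_number_le_iff[OF simple_graph_one_removed[OF assms(1)]] assms(2) by metis
  show thesis
    by (rule that[OF f(1), of c]) (use c in \<open>auto simp: proper_colouring_def\<close>)
qed

lemma proper_edge_colouring_mono:
  "proper_edge_colouring G k c \<Longrightarrow> k \<le> l \<Longrightarrow> proper_edge_colouring G l c"
  unfolding proper_edge_colouring_def by (auto simp: Pi_iff intro: less_le_trans)

lemma chromatic_index_le_iff:
  assumes "simple_graph G"
  shows "chromatic_index G \<le> k \<longleftrightarrow> (\<exists>c. proper_edge_colouring G k c)"
proof
  obtain c :: "'a set \<Rightarrow> nat" and n where c: "inj_on c (edges G)" "c ` edges G = {..<n}"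
    using finite_imp_inj_to_nat_seg[OF finite_edges[OF assms]] by (metis lessThan_def)
  have "proper_edge_colouring G n c"
    unfolding proper_edge_colouring_def
  proof (intro conjI ballI impI)
    show "c \<in> edges G \<rightarrow> {..<n}" using c by blast
    show "c e \<noteq> c e'" if "e \<in> edges G" "e' \<in> edges G" "e \<noteq> e' \<and> e \<inter> e' \<noteq> {}" for e e'
      using that c(1) by (metis inj_onD)
  qed
  then have "\<exists>n c. proper_edge_colouring G n c" by blast
  from LeastI_ex[OF this] obtain c where "proper_edge_colouring G (chromatic_index G) c"
    unfolding chromatic_index_def by blast
  moreover assume "chromatic_index G \<le> k"
  ultimately show "\<exists>c. proper_edge_colouring G k c" using proper_edge_colouring_mono by blast
next
  assume "\<exists>c. proper_edge_colouring G k c"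
  then show "chromatic_index G \<le> k" unfolding chromatic_index_def by (rule Least_le)
qed

lemma finite_cliques: "simple_graph G \<Longrightarrow> finite {K. is_clique G K}"
  by (rule finite_subset[of _ "Pow (verts G)"]) (auto simp: is_clique_def simple_graph_def)

lemma clique_number_ge: "simple_graph G \<Longrightarrow> is_clique G K \<Longrightarrow> card K \<le> clique_number G"
  unfolding clique_number_def using finite_cliques by (intro Max_ge) auto

lemma clique_numberE:
  assumes "simple_graph G"
  obtains K where "is_clique G K" "card K = clique_number G"
proof -
  have "is_clique G {}" by (simp add: is_clique_def clique_def)
  then have "card ` {K. is_clique G K} \<noteq> {}" by blast
  from Max_in[OF finite_imageI[OF finite_cliques[OF assms]] this] show thesis
    using that unfolding clique_number_def by auto
qed

lemma clique_number_le_chromatic_number: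
  assumes "simple_graph G" shows "clique_number G \<le> chromatic_number G"
proof -
  obtain K where K: "is_clique G K" "card K = clique_number G" using clique_numberE[OF assms] .
  obtain c where c: "proper_colouring G (chromatic_number G) c"
    using chromatic_number_le_iff[OF assms] by blast
  have "inj_on c K"
    using K c unfolding inj_on_def is_clique_def clique_def proper_colouring_def by blast
  moreover have "c ` K \<subseteq> {..<chromatic_number G}"
    using K c unfolding is_clique_def proper_colouring_def by blast
  ultimately show ?thesis using card_inj_on_le[of c K "{..<chromatic_number G}"] K by simp
qed

lemma partition_of_colouring:
  fixes k :: nat
  assumes c: "c \<in> V \<rightarrow> {..<k}" and Q: "\<And>i. i < k \<Longrightarrow> Q {v \<in> V. c v = i}"
  shows "(LEAST k. \<exists>P. partition_on V P \<and> card P = k \<and> (\<forall>W\<in>P. Q W)) \<le> k"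
proof -
  \<comment> \<open>Colours outside the image are dropped, because \<open>partition_on\<close>
    admits no empty class; hence only at most \<open>k\<close> classes.\<close>
  define P where "P = (\<lambda>i. {v \<in> V. c v = i}) ` (c ` V)"
  have "partition_on V P"
    unfolding P_def by (auto intro!: partition_onI simp: disjnt_def)
  moreover have "\<forall>W\<in>P. Q W" using c Q unfolding P_def by auto
  moreover have "card P \<le> k"
  proof -
    have "c ` V \<subseteq> {..<k}" using c by auto
    then have "card (c ` V) \<le> k" "finite (c ` V)"
      using card_mono[of "{..<k}" "c ` V"] finite_subset by auto
    then show ?thesis unfolding P_def using card_image_le le_trans by blast
  qed
  moreover have "(LEAST k. \<exists>P. partition_on V P \<and> card P = k \<and> (\<forall>W\<in>P. Q W)) \<le> card P"
    by (rule Least_le) (use calculation in blast)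
  ultimately show ?thesis by linarith
qed

text \<open>The partition into singletons shows that the minimum exists, and a numbering of an
  optimal partition is the colouring. The last hypothesis has the shape of a definition, so that
  \<open>clique_cover_number_def\<close> and \<open>vertex_arboricity_def\<close> can be supplied as
  they stand.\<close>

lemma colouring_of_partition:
  fixes k :: nat
  assumes "finite V" and "\<And>v. v \<in> V \<Longrightarrow> Q {v}"
    and k: "k = (LEAST k. \<exists>P. partition_on V P \<and> card P = k \<and> (\<forall>W\<in>P. Q W))"
  shows "\<exists>c\<in>V \<rightarrow> {..<k}. \<forall>i<k. Q {v \<in> V. c v = i}"
proof -
  have "partition_on V ((\<lambda>v. {v}) ` V)" by (auto intro!: partition_onI simp: disjnt_def)
  then have "\<exists>k P. partition_on V P \<and> card P = k \<and> (\<forall>W\<in>P. Q W)"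
    using assms(2) by blast
  from LeastI_ex[OF this] obtain P where P: "partition_on V P" "card P = k" "\<forall>W\<in>P. Q W"
    unfolding k by blast
  have "finite P"
    using partition_onD1[OF P(1)] assms(1) by (metis finite_UnionD)
  then obtain h where h: "bij_betw h P {..<k}"
    using P(2) ex_bij_betw_finite_nat[of P] by (auto simp: atLeast0LessThan)
  define c where "c v = h (THE W. W \<in> P \<and> v \<in> W)" for v
  have c: "c v = h W" if "W \<in> P" "v \<in> W" for v W
  proof -
    have "(THE W. W \<in> P \<and> v \<in> W) = W"
      using that partition_onD2[OF P(1)] by (intro the_equality) (auto simp: disjoint_def)
    then show ?thesis by (simp add: c_def)
  qed
  have "{v \<in> V. c v = h W} = W" if W: "W \<in> P" for W
  proof -
    have "v \<in> W" if v: "v \<in> V" "c v = h W" for v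
    proof -
      obtain U where U: "U \<in> P" "v \<in> U" using v partition_onD1[OF P(1)] by blast
      then have "h U = h W" using c[of U v] v by simp
      then show ?thesis using U W bij_betw_imp_inj_on[OF h] by (auto dest: inj_onD)
    qed
    then show ?thesis using c W partition_onD1[OF P(1)] by auto
  qed
  moreover have "i \<in> h ` P" if "i < k" for i
    using h that by (auto simp: bij_betw_def)
  ultimately have "\<forall>i<k. Q {v \<in> V. c v = i}" using P(3) by fastforce
  moreover have "c \<in> V \<rightarrow> {..<k}"
  proof
    fix v assume "v \<in> V"
    then obtain U where "U \<in> P" "v \<in> U" using partition_onD1[OF P(1)] by blast
    then show "c v \<in> {..<k}" using c[of U v] bij_betwE[OF h] by simp
  qed
  ultimately show ?thesis by blast
qed

section \<open>Degeneracy, forests and removable edge sets\<close>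

text \<open>
  The reserved vertex \<open>w\<close> makes the induction work: after an edge \<open>wx\<close> has been selected by \<open>x\<close>,
  the vertex \<open>x\<close> has degree at most \<open>1\<close> and becomes the reserved one.
\<close>

lemma max_degree_two_orientation:
  assumes "finite E" "\<And>e. e \<in> E \<Longrightarrow> card e = 2" "\<And>v. card {e \<in> E. v \<in> e} \<le> 2"
    and "card {e \<in> E. w \<in> e} \<le> 1"
  shows "\<exists>f. (\<forall>v. f v \<in> insert {} E \<and> (f v \<noteq> {} \<longrightarrow> v \<in> f v)) \<and> f w = {} \<and> E \<subseteq> range f"
  using assms
proof (induction "card E" arbitrary: E w)
  case 0
  then show ?case by (intro exI[of _ "\<lambda>_. {}"]) auto
next
  case (Suc n)
  then have "E \<noteq> {}" by auto
  \<comment> \<open>An edge at the reserved vertex is taken if there is one; it is then the only one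
    there.\<close>
  then obtain e where e: "e \<in> E" "(\<exists>e\<in>E. w \<in> e) \<Longrightarrow> w \<in> e" by blast
  obtain x where x: "x \<in> e" "x \<noteq> w"
    using Suc.prems(2)[OF e(1)] by (metis card_2_iff insertI1 insertI2)
  define E' where "E' = E - {e}"
  have deg: "card {e \<in> E'. v \<in> e} \<le> 2" for v
  proof -
    have "card {e \<in> E'. v \<in> e} \<le> card {e \<in> E. v \<in> e}"
      using Suc.prems(1) by (intro card_mono) (auto simp: E'_def)
    then show ?thesis using Suc.prems(3)[of v] by simp
  qed
  have "{e \<in> E'. x \<in> e} = {e \<in> E. x \<in> e} - {e}" by (auto simp: E'_def)
  then have degx: "card {e \<in> E'. x \<in> e} \<le> 1"
    using Suc.prems(1) Suc.prems(3)[of x] e x by (simp add: card_Diff_singleton)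
  have nE': "n = card E'" "finite E'"
    using Suc.hyps(2) Suc.prems(1) e by (auto simp: E'_def)
  have two: "card e' = 2" if "e' \<in> E'" for e' using that Suc.prems(2) by (simp add: E'_def)
  have "\<exists>f. (\<forall>v. f v \<in> insert {} E' \<and> (f v \<noteq> {} \<longrightarrow> v \<in> f v)) \<and> f x = {} \<and> E' \<subseteq> range f"
    by (rule Suc.hyps(1)[OF nE' _ deg degx]) (rule two)
  then obtain f where f': "\<forall>v. f v \<in> insert {} E' \<and> (f v \<noteq> {} \<longrightarrow> v \<in> f v)"
      and f3: "f x = {}" and f4: "E' \<subseteq> range f"
    by (elim exE conjE) (rule that)
  have f: "f v \<in> insert {} E'" "f v \<noteq> {} \<Longrightarrow> v \<in> f v" for v
    using f' by simp_all
  \<comment> \<open>Any edge selected by \<open>w\<close> would be a second edge at \<open>w\<close>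
    besides \<open>e\<close>.\<close>
  have fw: "f w = {}"
  proof (rule ccontr)
    assume "f w \<noteq> {}"
    then have "w \<in> f w" "f w \<in> E" "f w \<noteq> e" using f(1,2)[of w] by (auto simp: E'_def)
    then have "{f w, e} \<subseteq> {e \<in> E. w \<in> e}" using e by blast
    then have "card {f w, e} \<le> card {e \<in> E. w \<in> e}"
      using Suc.prems(1) by (intro card_mono) auto
    then show False using Suc.prems(4) \<open>f w \<noteq> e\<close> by simp
  qed
  have "E \<subseteq> range (f(x := e))"
  proof
    fix e' assume e': "e' \<in> E"
    show "e' \<in> range (f(x := e))"
    proof (cases "e' = e")
      case True
      then show ?thesis by (metis fun_upd_same rangeI)
    next
      case False
      then obtain v where v: "f v = e'" using f4 e' by (auto simp: E'_def)
      then have "v \<noteq> x" using f3 Suc.prems(2)[OF e'] by auto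
      then show ?thesis using v by (metis fun_upd_other rangeI)
    qed
  qed
  moreover have "(f(x := e)) v \<in> insert {} E \<and> ((f(x := e)) v \<noteq> {} \<longrightarrow> v \<in> (f(x := e)) v)" for v
    using f(1,2)[of v] e(1) x(1) by (cases "v = x") (auto simp: E'_def)
  moreover have "(f(x := e)) w = {}" using fw x(2) by simp
  ultimately show ?case by blast
qed

text \<open>On a cycle no vertex of degree at most 1 is available to be reserved. Deleting one edge
  \<open>e\<close> at \<open>u\<close> makes \<open>u\<close> such a vertex; the reserved
  \<open>u\<close> selects nothing else and is free to select \<open>e\<close> at the end.\<close>

lemma max_degree_two_selection:
  assumes G: "simple_graph G" and F: "F \<subseteq> edges G" "\<And>v. card {e \<in> F. v \<in> e} \<le> 2"
  shows "\<exists>f. one_selection G f \<and> F \<subseteq> f ` verts G"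
proof (cases "F = {}")
  case True
  then show ?thesis using one_selection_empty by blast
next
  case False
  then obtain e where e: "e \<in> F" by blast
  then obtain u x where u: "e = {u, x}" using edgeE[OF G] F(1) by blast
  have fin: "finite F" using finite_subset[OF F(1) finite_edges[OF G]] .
  have deg: "card {e' \<in> F - {e}. v \<in> e'} \<le> 2" for v
  proof -
    have "card {e' \<in> F - {e}. v \<in> e'} \<le> card {e' \<in> F. v \<in> e'}"
      using fin by (intro card_mono) auto
    then show ?thesis using F(2)[of v] by simp
  qed
  have "{e' \<in> F - {e}. u \<in> e'} = {e' \<in> F. u \<in> e'} - {e}" by auto
  then have degu: "card {e' \<in> F - {e}. u \<in> e'} \<le> 1"
    using fin F(2)[of u] e u by (simp add: card_Diff_singleton)
  have two: "card e' = 2" if "e' \<in> F - {e}" for e'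
    using that F(1) card_edge[OF G] by blast
  have "\<exists>f. (\<forall>v. f v \<in> insert {} (F - {e}) \<and> (f v \<noteq> {} \<longrightarrow> v \<in> f v)) \<and> f u = {} \<and>
      F - {e} \<subseteq> range f"
    by (rule max_degree_two_orientation[OF finite_Diff[OF fin] _ deg degu]) (rule two)
  then obtain f where f': "\<forall>v. f v \<in> insert {} (F - {e}) \<and> (f v \<noteq> {} \<longrightarrow> v \<in> f v)"
      and f3: "f u = {}" and f4: "F - {e} \<subseteq> range f"
    by (elim exE conjE) (rule that)
  have f: "f v \<in> insert {} (F - {e})" "f v \<noteq> {} \<Longrightarrow> v \<in> f v" for v
    using f' by simp_all
  have "one_selection G (f(u := e))"
    unfolding one_selection_def
  proof (intro conjI ballI impI Pi_I)
    fix v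
    show "(f(u := e)) v \<in> edges G \<union> {{}}" using f(1)[of v] F(1) e by auto
    show "v \<in> (f(u := e)) v" if "(f(u := e)) v \<noteq> {}"
      using that f(2)[of v] u by (cases "v = u") auto
  qed
  moreover have "F \<subseteq> (f(u := e)) ` verts G"
  proof
    fix e' assume e': "e' \<in> F"
    then have sub: "e' \<subseteq> verts G" "e' \<noteq> {}" using edge_subset_verts[OF G] card_edge[OF G] F(1) by fastforce+
    show "e' \<in> (f(u := e)) ` verts G"
    proof (cases "e' = e")
      case True
      then show ?thesis using sub u by (auto intro!: image_eqI[of _ _ u])
    next
      case False
      then obtain v where v: "f v = e'" using f4 e' by auto
      then have "v \<noteq> u" "v \<in> verts G" using f(2)[of v] f3 sub by auto
      then show ?thesis using v by (auto intro!: image_eqI[of _ _ v])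
    qed
  qed
  ultimately show ?thesis by blast
qed

lemma handshake:
  assumes "finite W" "finite F" "\<And>e. e \<in> F \<Longrightarrow> e \<subseteq> W \<and> card e = 2"
  shows "(\<Sum>v\<in>W. card {e \<in> F. v \<in> e}) = 2 * card F"
proof (rule sum_multicount[OF assms(1,2)])
  have "{v \<in> W. v \<in> e} = e" if "e \<in> F" for e using assms(3)[OF that] by blast
  then show "\<forall>e\<in>F. card {v \<in> W. v \<in> e} = 2" using assms(3) by simp
qed

lemma finite_verts: "simple_graph G \<Longrightarrow> finite (verts G)"
  by (simp add: simple_graph_def)

text \<open>If all degrees inside \<open>W\<close> were at least 3, there would be at least 3|W|/2
  removed edges inside \<open>W\<close>, but their selectors lie in \<open>W\<close>.\<close>

lemma selection_two_degenerate:
  assumes G: "simple_graph G" and f: "one_selection G f" and W: "W \<subseteq> verts G" "W \<noteq> {}"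
  shows "\<exists>v\<in>W. card {e \<in> edges G \<inter> f ` verts G. e \<subseteq> W \<and> v \<in> e} \<le> 2"
proof (rule ccontr)
  assume "\<not> ?thesis"
  then have deg: "3 \<le> card {e \<in> edges G \<inter> f ` verts G. e \<subseteq> W \<and> v \<in> e}" if "v \<in> W" for v
    using that by force
  define F where "F = {e \<in> edges G \<inter> f ` verts G. e \<subseteq> W}"
  have finW: "finite W" using W finite_verts[OF G] finite_subset by blast
  have "F \<subseteq> f ` W"
  proof
    fix e assume "e \<in> F"
    then obtain v where v: "v \<in> verts G" "e = f v" "e \<in> edges G" "e \<subseteq> W" by (auto simp: F_def)
    then have "v \<in> e" using f card_edge[OF G] unfolding one_selection_def by fastforce
    then show "e \<in> f ` W" using v by auto
  qed
  then have "card F \<le> card W"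
    using card_image_le[OF finW, of f] card_mono[of "f ` W" F] finW by simp
  moreover have "(\<Sum>v\<in>W. card {e \<in> F. v \<in> e}) = 2 * card F"
    using finW finite_edges[OF G] card_edge[OF G] by (intro handshake) (auto simp: F_def)
  moreover have "(\<Sum>v\<in>W. 3) \<le> (\<Sum>v\<in>W. card {e \<in> F. v \<in> e})"
    using deg by (intro sum_mono) (simp add: F_def conj_ac)
  moreover have "card W > 0" using W finW by auto
  ultimately show False by simp
qed

text \<open>A vertex \<open>v\<close> with at most \<open>d\<close> edges is set aside and the rest
  is coloured first. As d < q * (t + 1), one of the \<open>q\<close> classes receives at most
  \<open>t\<close> of the edges at \<open>v\<close>, and \<open>v\<close> joins it. The predicate
  \<open>P\<close> will be independence for \<open>t = 0\<close> and being a forest for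
  \<open>t = 1\<close>.\<close>

lemma degenerate_colouring:
  assumes "finite W" "finite E" "\<And>e. e \<in> E \<Longrightarrow> card e = 2"
    and deg: "\<And>U. U \<subseteq> W \<Longrightarrow> U \<noteq> {} \<Longrightarrow> \<exists>v\<in>U. card {e \<in> E. e \<subseteq> U \<and> v \<in> e} \<le> d"
    and q: "d < q * (t + 1)" and P0: "P {}"
    and PS: "\<And>U v. U \<subseteq> W \<Longrightarrow> v \<in> W - U \<Longrightarrow> P U \<Longrightarrow>
      card {e \<in> E. e \<subseteq> insert v U \<and> v \<in> e} \<le> t \<Longrightarrow> P (insert v U)"
  shows "\<exists>c\<in>W \<rightarrow> {..<q::nat}. \<forall>i. P {v \<in> W. c v = i}"
  using assms(1,4,7)
proof (induction "card W" arbitrary: W)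
  case 0
  then show ?case using P0 by simp
next
  case (Suc n)
  then have "W \<noteq> {}" by auto
  with Suc.prems(2)[of W] obtain v where v: "v \<in> W" "card {e \<in> E. e \<subseteq> W \<and> v \<in> e} \<le> d"
    by blast
  define W' where "W' = W - {v}"
  have "\<exists>c\<in>W' \<rightarrow> {..<q}. \<forall>i. P {v \<in> W'. c v = i}"
  proof (rule Suc.hyps(1))
    show "n = card W'" "finite W'" using Suc.hyps(2) Suc.prems(1) v by (auto simp: W'_def)
    show "\<exists>v\<in>U. card {e \<in> E. e \<subseteq> U \<and> v \<in> e} \<le> d" if "U \<subseteq> W'" "U \<noteq> {}" for U
      using Suc.prems(2)[of U] that by (auto simp: W'_def)
    show "P (insert x U)" if "U \<subseteq> W'" "x \<in> W' - U" "P U"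
        "card {e \<in> E. e \<subseteq> insert x U \<and> x \<in> e} \<le> t" for U x
      using Suc.prems(3)[of U x] that by (auto simp: W'_def)
  qed
  then obtain c where c: "c \<in> W' \<rightarrow> {..<q}" "\<And>i. P {v \<in> W'. c v = i}" by blast
  define S where "S i = {e \<in> E. e \<subseteq> insert v {u \<in> W'. c u = i} \<and> v \<in> e}" for i
  have finS: "finite (S i)" for i using assms(2) by (simp add: S_def)
  \<comment> \<open>An edge counted for two colours would lie inside \<open>{v}\<close>.\<close>
  have "S i \<inter> S j = {}" if "i \<noteq> j" for i j
  proof (rule ccontr)
    assume "S i \<inter> S j \<noteq> {}"
    then obtain e where e: "e \<in> S i" "e \<in> S j" by blast
    then have "e \<subseteq> {v}" using that by (auto simp: S_def)
    then have "card e \<le> 1" using card_mono[of "{v}" e] by simp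
    moreover have "card e = 2" using e assms(3) by (simp add: S_def)
    ultimately show False by simp
  qed
  then have "(\<Sum>i<q. card (S i)) = card (\<Union>i<q. S i)"
    using finS by (subst card_UN_disjoint) auto
  also have "\<dots> \<le> card {e \<in> E. e \<subseteq> W \<and> v \<in> e}"
    using assms(2) v by (intro card_mono) (auto simp: S_def W'_def)
  also have "\<dots> < q * (t + 1)" using v q by simp
  finally have sum: "(\<Sum>i<q. card (S i)) < q * (t + 1)" .
  have "\<exists>i<q. card (S i) \<le> t"
  proof (rule ccontr)
    assume "\<not> ?thesis"
    then have "(\<Sum>i<q. t + 1) \<le> (\<Sum>i<q. card (S i))" by (intro sum_mono) force
    then show False using sum by simp
  qed
  then obtain i where i: "i < q" "card (S i) \<le> t" by blast
  have "P {u \<in> W. (c(v := i)) u = j}" for j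
  proof (cases "j = i")
    case True
    have "{u \<in> W. (c(v := i)) u = i} = insert v {u \<in> W'. c u = i}"
      using v by (auto simp: W'_def)
    moreover have "P (insert v {u \<in> W'. c u = i})"
      using c(2) i(2) v by (intro Suc.prems(3)) (auto simp: W'_def S_def)
    ultimately show ?thesis using True by simp
  next
    case False
    then have "{u \<in> W. (c(v := i)) u = j} = {u \<in> W'. c u = j}" by (auto simp: W'_def)
    then show ?thesis using c(2) by simp
  qed
  moreover have "c(v := i) \<in> W \<rightarrow> {..<q}" using c(1) i by (auto simp: W'_def)
  ultimately show ?case by blast
qed

section \<open>Forests and their leaves\<close>

lemma verts_induced_subgraph [simp]: "verts (induced_subgraph G W) = W"
  and edges_induced_subgraph [simp]: "edges (induced_subgraph G W) = {e \<in> edges G. e \<subseteq> W}"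
  by (simp_all add: induced_subgraph_def)

lemma is_forest_mono: "is_forest H \<Longrightarrow> edges G \<subseteq> edges H \<Longrightarrow> is_forest G"
  unfolding is_forest_def is_cycle_def by blast

lemma is_forest_no_edges: "edges G = {} \<Longrightarrow> is_forest G"
  unfolding is_forest_def is_cycle_def by (metis empty_iff gr0I le_zero_eq zero_neq_numeral)

lemma cycle_two_neighbours:
  assumes "is_cycle G xs" "v \<in> set xs"
  shows "\<exists>a b. a \<noteq> b \<and> a \<in> set xs \<and> b \<in> set xs \<and> {v, a} \<in> edges G \<and> {v, b} \<in> edges G"
proof -
  obtain i where i: "i < length xs" "xs ! i = v" using assms(2) by (auto simp: in_set_conv_nth)
  have xs: "3 \<le> length xs" "distinct xs"
    and E: "\<And>i. i < length xs \<Longrightarrow> {xs ! i, xs ! (Suc i mod length xs)} \<in> edges G"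
    using assms(1) by (auto simp: is_cycle_def)
  define a where "a = (if Suc i = length xs then 0 else Suc i)"
  define b where "b = (if i = 0 then length xs - 1 else i - 1)"
  have a: "a < length xs" "Suc i mod length xs = a" using i by (auto simp: a_def)
  have b: "b < length xs" "Suc b mod length xs = i" using i by (auto simp: b_def)
  \<comment> \<open>Length at least 3 keeps the cyclic successor and predecessor of position
    \<open>i\<close> apart.\<close>
  have "a \<noteq> b" using xs(1) i by (auto simp: a_def b_def)
  then have "xs ! a \<noteq> xs ! b" using a b xs(2) by (simp add: nth_eq_iff_index_eq)
  then show ?thesis
    using E[OF i(1)] E[OF b(1)] a b i by (metis insert_commute nth_mem)
qed

text \<open>A cycle through \<open>v\<close> would use two edges at \<open>v\<close>.\<close>

lemma is_forest_insert:
  assumes G: "simple_graph G" and U: "is_forest (induced_subgraph G U)"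
    and v: "card {e \<in> edges G. e \<subseteq> insert v U \<and> v \<in> e} \<le> 1"
  shows "is_forest (induced_subgraph G (insert v U))"
  unfolding is_forest_def
proof
  assume "\<exists>xs. is_cycle (induced_subgraph G (insert v U)) xs"
  then obtain xs where xs: "is_cycle (induced_subgraph G (insert v U)) xs" by blast
  show False
  proof (cases "v \<in> set xs")
    case True
    then obtain a b where ab: "a \<noteq> b" "{v, a} \<in> edges G" "{v, b} \<in> edges G"
      "{v, a} \<subseteq> insert v U" "{v, b} \<subseteq> insert v U"
      using cycle_two_neighbours[OF xs True] by auto
    then have "{{v, a}, {v, b}} \<subseteq> {e \<in> edges G. e \<subseteq> insert v U \<and> v \<in> e}" by blast
    then have "card {{v, a}, {v, b}} \<le> card {e \<in> edges G. e \<subseteq> insert v U \<and> v \<in> e}"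
      using finite_edges[OF G] by (intro card_mono) auto
    moreover have "{v, a} \<noteq> {v, b}" using ab(1) by (simp add: doubleton_eq_iff)
    ultimately show False using v by simp
  next
    case False
    have "is_cycle (induced_subgraph G U) xs"
      unfolding is_cycle_def
    proof (intro conjI allI impI)
      show "3 \<le> length xs" "distinct xs" using xs by (auto simp: is_cycle_def)
      fix i assume i: "i < length xs"
      then have "{xs ! i, xs ! (Suc i mod length xs)} \<in> edges (induced_subgraph G (insert v U))"
        using xs by (simp add: is_cycle_def)
      moreover have "xs ! i \<noteq> v" "xs ! (Suc i mod length xs) \<noteq> v"
        using False i by (metis nth_mem, metis mod_less_divisor nth_mem length_pos_if_in_set)
      ultimately show "{xs ! i, xs ! (Suc i mod length xs)} \<in> edges (induced_subgraph G U)"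
        by auto
    qed
    then show False using U by (simp add: is_forest_def)
  qed
qed

text \<open>The first vertex of a longest path would have a second neighbour. By maximality it lies
  on the path and closes a cycle.\<close>

lemma forest_leaf:
  assumes G: "simple_graph G" and W: "finite W" "W \<noteq> {}"
    and forest: "is_forest (induced_subgraph G W)"
  shows "\<exists>v\<in>W. card {e \<in> edges G. e \<subseteq> W \<and> v \<in> e} \<le> 1"
proof (rule ccontr)
  assume "\<not> ?thesis"
  then have deg: "2 \<le> card {e \<in> edges G. e \<subseteq> W \<and> v \<in> e}" if "v \<in> W" for v
    using that by force
  have next_vertex: "\<exists>u\<in>W. u \<noteq> v \<and> u \<noteq> p \<and> {v, u} \<in> edges G" if v: "v \<in> W" for v p
  proof (rule ccontr)
    assume no: "\<not> ?thesis"
    have "{e \<in> edges G. e \<subseteq> W \<and> v \<in> e} \<subseteq> {{v, p}}"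
    proof
      fix e assume e: "e \<in> {e \<in> edges G. e \<subseteq> W \<and> v \<in> e}"
      then obtain u where "e = {v, u}" "u \<noteq> v" using edge_other_end[OF G, of e v] by auto
      then show "e \<in> {{v, p}}" using no e by auto
    qed
    then have "card {e \<in> edges G. e \<subseteq> W \<and> v \<in> e} \<le> card {{v, p}}"
      by (intro card_mono) auto
    then show False using deg[OF v] by simp
  qed
  define path where "path xs \<longleftrightarrow> xs \<noteq> [] \<and> distinct xs \<and> set xs \<subseteq> W \<and>
      (\<forall>i. Suc i < length xs \<longrightarrow> {xs ! i, xs ! Suc i} \<in> edges G)" for xs
  obtain w where "w \<in> W" using W by blast
  then have "path [w]" by (simp add: path_def)
  moreover have "\<forall>xs. path xs \<longrightarrow> length xs < Suc (card W)"
    unfolding path_def using W(1) by (metis card_mono distinct_card less_Suc_eq_le)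
  ultimately obtain xs where xs: "path xs" "\<And>ys. path ys \<Longrightarrow> length ys \<le> length xs"
    using ex_has_greatest_nat[of path "[w]" length "Suc (card W)"] by auto
  have ne: "xs \<noteq> []" and dist: "distinct xs" and sub: "set xs \<subseteq> W"
    and E: "\<And>i. Suc i < length xs \<Longrightarrow> {xs ! i, xs ! Suc i} \<in> edges G"
    using xs(1) by (auto simp: path_def)
  have "xs ! 0 \<in> W" using ne sub by (meson length_greater_0_conv nth_mem subsetD)
  \<comment> \<open>On a path with one vertex \<open>xs ! 1\<close> is an unspecified value, which
    is harmless: \<open>next_vertex\<close> avoids an arbitrary \<open>p\<close>.\<close>
  then obtain u where u: "u \<in> W" "u \<noteq> xs ! 0" "u \<noteq> xs ! 1" "{xs ! 0, u} \<in> edges G"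
    using next_vertex by blast
  show False
  proof (cases "u \<in> set xs")
    case False
    have "path (u # xs)"
      unfolding path_def
      using ne dist sub E u False by (auto simp: nth_Cons insert_commute split: nat.split)
    then show False using xs(2) by fastforce
  next
    case True
    then obtain j where j: "j < length xs" "xs ! j = u" by (auto simp: in_set_conv_nth)
    then have "j \<noteq> 0" "j \<noteq> 1" using u by metis+
    define ys where "ys = take (Suc j) xs"
    have len: "length ys = Suc j" using j by (simp add: ys_def)
    have "is_cycle (induced_subgraph G W) ys"
      unfolding is_cycle_def
    proof (intro conjI allI impI)
      show "3 \<le> length ys" using len \<open>j \<noteq> 0\<close> \<open>j \<noteq> 1\<close> by simp
      show "distinct ys" using dist by (simp add: ys_def)
      fix i assume i: "i < length ys"
      then have nth: "ys ! i = xs ! i" "ys ! (Suc i mod length ys) = xs ! (Suc i mod length ys)"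
        using len by (simp_all add: ys_def)
      have "{xs ! i, xs ! (Suc i mod length ys)} \<in> edges G"
        using E[of i] u(4) i j len by (cases "i = j") (auto simp: insert_commute)
      moreover have "ys ! i \<in> W" "ys ! (Suc i mod length ys) \<in> W"
        using i j len mod_less_divisor[of "Suc j" "Suc i"] unfolding nth
        by (auto intro!: subsetD[OF sub] nth_mem simp del: mod_less_divisor)
      ultimately show "{ys ! i, ys ! (Suc i mod length ys)} \<in> edges (induced_subgraph G W)"
        unfolding nth by simp
    qed
    then show False using forest by (auto simp: is_forest_def)
  qed
qed

text \<open>Leaves are stripped one by one, each selecting its last remaining edge. All edges inside
  \<open>W\<close> are selected from within \<open>W\<close>, so that the selections for disjoint
  sets can later be merged.\<close>

lemma forest_selection:
  assumes G: "simple_graph G" and "finite W" "is_forest (induced_subgraph G W)"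
  shows "\<exists>f. (\<forall>v. f v \<in> edges G \<union> {{}} \<and> (f v \<noteq> {} \<longrightarrow> v \<in> f v)) \<and>
    {e \<in> edges G. e \<subseteq> W} \<subseteq> f ` W"
  using assms(2,3)
proof (induction "card W" arbitrary: W)
  case 0
  then have "{e \<in> edges G. e \<subseteq> W} = {}" using card_edge[OF G] by fastforce
  then show ?case by (intro exI[of _ "\<lambda>_. {}"]) auto
next
  case (Suc n)
  then have "W \<noteq> {}" by auto
  then obtain v where v: "v \<in> W" "card {e \<in> edges G. e \<subseteq> W \<and> v \<in> e} \<le> 1"
    using forest_leaf[OF G Suc.prems(1)] Suc.prems(2) by blast
  have "is_forest (induced_subgraph G (W - {v}))"
    using Suc.prems(2) by (rule is_forest_mono) auto
  moreover have "n = card (W - {v})" "finite (W - {v})" using Suc.hyps(2) Suc.prems(1) v by auto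
  ultimately have "\<exists>f. (\<forall>v. f v \<in> edges G \<union> {{}} \<and> (f v \<noteq> {} \<longrightarrow> v \<in> f v)) \<and>
      {e \<in> edges G. e \<subseteq> W - {v}} \<subseteq> f ` (W - {v})"
    using Suc.hyps(1)[of "W - {v}"] by simp
  then obtain f where f': "\<forall>v. f v \<in> edges G \<union> {{}} \<and> (f v \<noteq> {} \<longrightarrow> v \<in> f v)"
      and f3: "{e \<in> edges G. e \<subseteq> W - {v}} \<subseteq> f ` (W - {v})"
    by (elim exE conjE) (rule that)
  have f: "f v \<in> edges G \<union> {{}}" "f v \<noteq> {} \<Longrightarrow> v \<in> f v" for v
    using f' by simp_all
  \<comment> \<open>The value \<open>{}\<close> stands for a vertex \<open>v\<close> that is
    isolated inside \<open>W\<close>.\<close>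
  obtain e where e: "e = {} \<or> e \<in> edges G \<and> v \<in> e" "{e \<in> edges G. e \<subseteq> W \<and> v \<in> e} \<subseteq> {e}"
  proof (cases "{e \<in> edges G. e \<subseteq> W \<and> v \<in> e} = {}")
    case True
    then show ?thesis using that[of "{}"] by blast
  next
    case False
    moreover have "finite {e \<in> edges G. e \<subseteq> W \<and> v \<in> e}" using finite_edges[OF G] by simp
    ultimately have "card {e \<in> edges G. e \<subseteq> W \<and> v \<in> e} \<noteq> 0" by (simp only: card_0_eq not_False_eq_True)
    then have "card {e \<in> edges G. e \<subseteq> W \<and> v \<in> e} = 1" using v(2) by linarith
    then obtain e where e: "{e \<in> edges G. e \<subseteq> W \<and> v \<in> e} = {e}" by (meson card_1_singletonE)
    then have "e \<in> {e \<in> edges G. e \<subseteq> W \<and> v \<in> e}" by simp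
    then show ?thesis using that[of e] e by blast
  qed
  have "{e \<in> edges G. e \<subseteq> W} \<subseteq> (f(v := e)) ` W"
  proof
    fix e' assume e': "e' \<in> {e \<in> edges G. e \<subseteq> W}"
    show "e' \<in> (f(v := e)) ` W"
    proof (cases "v \<in> e'")
      case True
      then have "e' = e" using e e' by blast
      then show ?thesis using v(1) by (auto intro!: image_eqI[of _ _ v])
    next
      case False
      then obtain u where "u \<in> W - {v}" "f u = e'" using f3 e' by blast
      then show ?thesis by (auto intro!: image_eqI[of _ _ u])
    qed
  qed
  then show ?case using f(1,2) e by (intro exI[of _ "f(v := e)"]) auto
qed

section \<open>General bounds\<close>

text \<open>Greedy colouring of the removed edges with \<open>d = 2\<close> and
  \<open>t = 0\<close>, for which three colours suffice.\<close>

lemma selection_three_colouring: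
  assumes G: "simple_graph G" and f: "one_selection G f"
  shows "\<exists>b\<in>verts G \<rightarrow> {..<3::nat}. \<forall>u v. {u, v} \<in> edges G \<inter> f ` verts G \<longrightarrow> b u \<noteq> b v"
proof -
  let ?E = "edges G \<inter> f ` verts G"
  have fin: "finite ?E" using finite_edges[OF G] by simp
  have "\<exists>b\<in>verts G \<rightarrow> {..<3::nat}. \<forall>i. \<forall>e\<in>?E. \<not> e \<subseteq> {v \<in> verts G. b v = i}"
  proof (rule degenerate_colouring[where d = 2 and t = 0 and E = ?E])
    show "finite (verts G)" "finite ?E" using finite_verts[OF G] fin by auto
    show "card e = 2" if "e \<in> ?E" for e using that card_edge[OF G] by blast
    show "\<exists>v\<in>U. card {e \<in> ?E. e \<subseteq> U \<and> v \<in> e} \<le> 2" if "U \<subseteq> verts G" "U \<noteq> {}" for U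
      by (rule selection_two_degenerate[OF G f that])
    show "\<forall>e\<in>?E. \<not> e \<subseteq> {}" using card_edge[OF G] by fastforce
    show "\<forall>e\<in>?E. \<not> e \<subseteq> insert v U"
      if "\<forall>e\<in>?E. \<not> e \<subseteq> U" "card {e \<in> ?E. e \<subseteq> insert v U \<and> v \<in> e} \<le> 0" for U v
    proof -
      have "{e \<in> ?E. e \<subseteq> insert v U \<and> v \<in> e} = {}" using that(2) fin by (simp del: Int_iff)
      then show ?thesis using that(1) by (metis (no_types, lifting) empty_iff mem_Collect_eq subset_insert)
    qed
  qed simp
  then obtain b where b: "b \<in> verts G \<rightarrow> {..<3::nat}"
    and b2: "\<forall>i. \<forall>e\<in>?E. \<not> e \<subseteq> {v \<in> verts G. b v = i}" by (elim bexE) (rule that)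
  have "b u \<noteq> b v" if "{u, v} \<in> ?E" for u v
    using bspec[OF spec[OF b2, of "b u"] that] edge_endpoints[OF G, of u v] that by auto
  then show ?thesis using b by blast
qed

lemma product_colour_bound:
  fixes i j k q :: nat
  assumes "i < k" "j < q" shows "q * i + j < q * k"
proof -
  have "q * i + j < q * (i + 1)" using assms(2) by simp
  also have "\<dots> \<le> q * k" using assms(1) by (intro mult_le_mono2) simp
  finally show ?thesis .
qed

lemma product_colour_inject:
  fixes i i' j j' q :: nat
  assumes "q * i + j = q * i' + j'" "j < q" "j' < q" shows "i = i' \<and> j = j'"
  using assms by (metis Groups.add_ac(2) add_left_cancel div_mult_self4 div_less add.right_neutral gr_implies_not0 mult.commute)

lemma chromatic_number_le_three_chromatic_number1:
  assumes G: "simple_graph G"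
  shows "chromatic_number G \<le> 3 * chromatic_number1 G"
proof -
  obtain f c where f: "one_selection G f" and c: "c \<in> verts G \<rightarrow> {..<chromatic_number1 G}"
    "\<And>u v. {u, v} \<in> edges G \<Longrightarrow> c u = c v \<Longrightarrow> {u, v} \<in> f ` verts G"
    using chromatic_number1_leE[OF G order_refl] by blast
  obtain b where b: "b \<in> verts G \<rightarrow> {..<3::nat}"
    "\<And>u v. {u, v} \<in> edges G \<Longrightarrow> {u, v} \<in> f ` verts G \<Longrightarrow> b u \<noteq> b v"
    using selection_three_colouring[OF G f] by blast
  \<comment> \<open>The pair \<open>(c v, b v)\<close> is written in base 3: \<open>c\<close>
    separates the ends of the remaining edges, \<open>b\<close> those of the removed ones.\<close>
  have "proper_colouring G (3 * chromatic_number1 G) (\<lambda>v. 3 * c v + b v)"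
    unfolding proper_colouring_def
  proof (intro conjI allI impI Pi_I)
    fix v assume v: "v \<in> verts G"
    have "c v < chromatic_number1 G" "b v < 3" using v b(1) c(1) by auto
    then show "3 * c v + b v \<in> {..<3 * chromatic_number1 G}"
      using product_colour_bound by simp
  next
    fix u v assume e: "{u, v} \<in> edges G"
    have "b u < 3" "b v < 3" using edge_endpoints[OF G e] b(1) by auto
    then show "3 * c u + b u \<noteq> 3 * c v + b v"
      using product_colour_inject[of 3 "c u" "b u" "c v" "b v"] b(2)[OF e] c(2)[OF e] by blast
  qed
  then show ?thesis using chromatic_number_le_iff[OF G] by blast
qed

lemma chromatic_number1_le_chromatic_number:
  "simple_graph G \<Longrightarrow> chromatic_number1 G \<le> chromatic_number G"
  using chromatic_number1_le[OF _ one_selection_empty] one_removed_empty by fastforce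

lemma clique_number1_le_clique_number:
  "simple_graph G \<Longrightarrow> clique_number1 G \<le> clique_number G"
  using clique_number1_le[OF _ one_selection_empty] one_removed_empty by fastforce

lemma clique_cover_number_le_clique_cover_number1:
  "simple_graph G \<Longrightarrow> clique_cover_number G \<le> clique_cover_number1 G"
  using clique_cover_number1_ge[OF _ one_selection_empty] one_removed_empty by fastforce

lemma is_clique_one_removed:
  assumes "is_clique G K" and "W \<subseteq> K"
    and "\<And>u v. u \<in> W \<Longrightarrow> v \<in> W \<Longrightarrow> {u, v} \<in> edges G \<Longrightarrow> {u, v} \<notin> f ` verts G"
  shows "is_clique (one_removed G f) W"
  unfolding is_clique_def clique_def verts_one_removed edges_one_removed
proof (intro conjI ballI impI DiffI)
  show "W \<subseteq> verts G" using assms(1,2) unfolding is_clique_def by blast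
  fix u v assume uv: "u \<in> W" "v \<in> W" "u \<noteq> v"
  then show "{u, v} \<in> edges G" using assms(1,2) unfolding is_clique_def clique_def by blast
  then show "{u, v} \<notin> f ` verts G" by (rule assms(3)[OF uv(1,2)])
qed

text \<open>Each of the three classes of \<open>b\<close> cuts a maximum clique in a set from which
  no edge is removed, so one third of the clique survives.\<close>

lemma clique_number_le_three_clique_number1:
  assumes G: "simple_graph G"
  shows "clique_number G \<le> 3 * clique_number1 G"
proof -
  obtain f where f: "one_selection G f" "clique_number1 G = clique_number (one_removed G f)"
    using clique_number1E[OF G] .
  obtain b where b: "b \<in> verts G \<rightarrow> {..<3::nat}"
    "\<And>u v. {u, v} \<in> edges G \<Longrightarrow> {u, v} \<in> f ` verts G \<Longrightarrow> b u \<noteq> b v"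
    using selection_three_colouring[OF G f(1)] by blast
  obtain K where K: "is_clique G K" "card K = clique_number G" using clique_numberE[OF G] .
  have class_le: "card {v \<in> K. b v = i} \<le> clique_number1 G" for i
  proof -
    have "is_clique (one_removed G f) {v \<in> K. b v = i}"
    proof (rule is_clique_one_removed[OF K(1)])
      show "{u, v} \<notin> f ` verts G"
        if "u \<in> {v \<in> K. b v = i}" "v \<in> {v \<in> K. b v = i}" "{u, v} \<in> edges G" for u v
        using b(2)[OF that(3)] that(1,2) by auto
    qed blast
    then show ?thesis using clique_number_ge[OF simple_graph_one_removed[OF G]] f(2) by simp
  qed
  have "K = (\<Union>i<3. {v \<in> K. b v = i})"
    using b(1) K(1) unfolding is_clique_def by auto
  then have "card K \<le> (\<Sum>i<3. card {v \<in> K. b v = i})"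
    using card_UN_le[of "{..<3::nat}" "\<lambda>i. {v \<in> K. b v = i}"] by simp
  also have "\<dots> \<le> (\<Sum>i<3::nat. clique_number1 G)" by (intro sum_mono class_le)
  finally show ?thesis using K(2) by simp
qed

text \<open>Cutting every clique of an optimal cover along the classes of \<open>b\<close> leaves
  cliques of the removed subgraph.\<close>

lemma clique_cover_number1_le_three_clique_cover_number:
  assumes G: "simple_graph G"
  shows "clique_cover_number1 G \<le> 3 * clique_cover_number G"
proof -
  obtain f where f: "one_selection G f" "clique_cover_number1 G = clique_cover_number (one_removed G f)"
    using clique_cover_number1E[OF G] .
  obtain b where b: "b \<in> verts G \<rightarrow> {..<3::nat}"
    "\<And>u v. {u, v} \<in> edges G \<Longrightarrow> {u, v} \<in> f ` verts G \<Longrightarrow> b u \<noteq> b v"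
    using selection_three_colouring[OF G f(1)] by blast
  have "\<exists>c\<in>verts G \<rightarrow> {..<clique_cover_number G}. \<forall>i<clique_cover_number G. is_clique G {v \<in> verts G. c v = i}"
    by (rule colouring_of_partition[OF finite_verts[OF G] _ clique_cover_number_def])
      (simp add: is_clique_def clique_def)
  then obtain c where c: "c \<in> verts G \<rightarrow> {..<clique_cover_number G}"
    "\<And>i. i < clique_cover_number G \<Longrightarrow> is_clique G {v \<in> verts G. c v = i}" by blast
  have "clique_cover_number (one_removed G f) \<le> 3 * clique_cover_number G"
    unfolding clique_cover_number_def[of "one_removed G f"] verts_one_removed
  proof (rule partition_of_colouring)
    show "(\<lambda>v. 3 * c v + b v) \<in> verts G \<rightarrow> {..<3 * clique_cover_number G}"
    proof
      fix v assume v: "v \<in> verts G"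
      have "c v < clique_cover_number G" "b v < 3" using v b(1) c(1) by auto
      then show "3 * c v + b v \<in> {..<3 * clique_cover_number G}"
        using product_colour_bound by simp
    qed
    fix i assume "i < 3 * clique_cover_number G"
    then have clq: "is_clique G {v \<in> verts G. c v = i div 3}" by (intro c(2)) simp
    have dm: "c v = i div 3 \<and> b v = i mod 3" if "v \<in> verts G" "3 * c v + b v = i" for v
    proof -
      have "b v < 3" using that b(1) by auto
      then show ?thesis using that(2) by auto
    qed
    show "is_clique (one_removed G f) {v \<in> verts G. 3 * c v + b v = i}"
    proof (rule is_clique_one_removed[OF clq])
      show "{v \<in> verts G. 3 * c v + b v = i} \<subseteq> {v \<in> verts G. c v = i div 3}"
        using dm by blast
      fix u v assume "u \<in> {v \<in> verts G. 3 * c v + b v = i}" "v \<in> {v \<in> verts G. 3 * c v + b v = i}"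
      then have "b u = b v" using dm by (metis (mono_tags, lifting) mem_Collect_eq)
      then show "{u, v} \<notin> f ` verts G" if "{u, v} \<in> edges G" using b(2) that by blast
    qed
  qed
  then show ?thesis using f(2) by simp
qed

section \<open>Vertex arboricity and degeneracy\<close>

lemma degenerate_forest_colouring:
  assumes G: "simple_graph G" and W: "finite W"
    and deg: "\<And>U. U \<subseteq> W \<Longrightarrow> U \<noteq> {} \<Longrightarrow> \<exists>v\<in>U. card {e \<in> edges G. e \<subseteq> U \<and> v \<in> e} \<le> d"
  shows "\<exists>c\<in>W \<rightarrow> {..<d div 2 + 1}. \<forall>i. is_forest (induced_subgraph G {v \<in> W. c v = i})"
\<comment> \<open>One edge into a forest keeps it a forest, hence \<open>t = 1\<close>; the count
  needs d < 2 * (d div 2 + 1).\<close>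
proof (rule degenerate_colouring[where E = "edges G" and d = d and t = 1])
  show "is_forest (induced_subgraph G {})"
  proof (rule is_forest_no_edges)
    show "edges (induced_subgraph G {}) = {}" using card_edge[OF G] by fastforce
  qed
  show "is_forest (induced_subgraph G (insert v U))"
    if "is_forest (induced_subgraph G U)" "card {e \<in> edges G. e \<subseteq> insert v U \<and> v \<in> e} \<le> 1" for U v
    using is_forest_insert[OF G that] .
qed (use W deg finite_edges[OF G] card_edge[OF G] in auto)

lemma min_degree_induced_le_iff:
  assumes "finite W" "W \<noteq> {}"
  shows "min_degree (induced_subgraph G W) \<le> d \<longleftrightarrow> (\<exists>v\<in>W. card {e \<in> edges G. e \<subseteq> W \<and> v \<in> e} \<le> d)"
  using assms by (simp add: min_degree_def degree_def Min_le_iff conj_assoc)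

lemma vertex_arboricity_leI:
  fixes k :: nat
  assumes "c \<in> verts G \<rightarrow> {..<k}" "\<And>i. i < k \<Longrightarrow> is_forest (induced_subgraph G {v \<in> verts G. c v = i})"
  shows "vertex_arboricity G \<le> k"
  unfolding vertex_arboricity_def using assms by (rule partition_of_colouring)

lemma vertex_arboricityE:
  assumes G: "simple_graph G"
  obtains c where "c \<in> verts G \<rightarrow> {..<vertex_arboricity G}"
    "\<And>i. i < vertex_arboricity G \<Longrightarrow> is_forest (induced_subgraph G {v \<in> verts G. c v = i})"
proof -
  have "\<exists>c\<in>verts G \<rightarrow> {..<vertex_arboricity G}. \<forall>i<vertex_arboricity G.
      is_forest (induced_subgraph G {v \<in> verts G. c v = i})"
  proof (rule colouring_of_partition[OF finite_verts[OF G] _ vertex_arboricity_def])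
    fix v
    show "is_forest (induced_subgraph G {v})"
    proof (rule is_forest_no_edges)
      show "edges (induced_subgraph G {v}) = {}"
        using card_edge[OF G] by (fastforce dest: subset_singletonD)
    qed
  qed
  then show thesis using that by blast
qed

lemma vertex_arboricity_degenerate:
  assumes G: "simple_graph G" and "degenerate d G"
  shows "vertex_arboricity G \<le> d div 2 + 1"
proof -
  have "\<exists>c\<in>verts G \<rightarrow> {..<d div 2 + 1}. \<forall>i. is_forest (induced_subgraph G {v \<in> verts G. c v = i})"
  proof (rule degenerate_forest_colouring[OF G finite_verts[OF G]])
    fix U assume U: "U \<subseteq> verts G" "U \<noteq> {}"
    then have "finite U" using finite_verts[OF G] finite_subset by blast
    then show "\<exists>v\<in>U. card {e \<in> edges G. e \<subseteq> U \<and> v \<in> e} \<le> d"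
      using assms(2) U min_degree_induced_le_iff[OF _ U(2), of G d] unfolding degenerate_def by blast
  qed
  then show ?thesis using vertex_arboricity_leI by blast
qed

text \<open>Each forest class is removed by selections of its own vertices. The classes are
  disjoint, so these combine into one selection \<open>h (c v) v\<close>.\<close>

lemma chromatic_number1_le_vertex_arboricity:
  assumes G: "simple_graph G"
  shows "chromatic_number1 G \<le> vertex_arboricity G"
proof -
  obtain c where c: "c \<in> verts G \<rightarrow> {..<vertex_arboricity G}"
    "\<And>i. i < vertex_arboricity G \<Longrightarrow> is_forest (induced_subgraph G {v \<in> verts G. c v = i})"
    using vertex_arboricityE[OF G] by blast
  define P where "P i f \<longleftrightarrow> (\<forall>v. f v \<in> edges G \<union> {{}} \<and> (f v \<noteq> {} \<longrightarrow> v \<in> f v)) \<and>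
      {e \<in> edges G. e \<subseteq> {v \<in> verts G. c v = i}} \<subseteq> f ` {v \<in> verts G. c v = i}" for i f
  have "\<forall>i\<in>{..<vertex_arboricity G}. \<exists>f. P i f"
    unfolding P_def using finite_verts[OF G] by (intro ballI forest_selection[OF G _ c(2)]) simp_all
  from bchoice[OF this] obtain h where "\<forall>i\<in>{..<vertex_arboricity G}. P i (h i)" ..
  then have h:
    "i < vertex_arboricity G \<Longrightarrow> h i v \<in> edges G \<union> {{}} \<and> (h i v \<noteq> {} \<longrightarrow> v \<in> h i v)"
    "i < vertex_arboricity G \<Longrightarrow>
      {e \<in> edges G. e \<subseteq> {v \<in> verts G. c v = i}} \<subseteq> h i ` {v \<in> verts G. c v = i}" for i v
    by (simp_all add: P_def)
  have cv: "c v < vertex_arboricity G" if "v \<in> verts G" for v using c(1) that by auto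
  have "one_selection G (\<lambda>v. h (c v) v)"
    unfolding one_selection_def
  proof (intro conjI ballI impI Pi_I)
    fix v assume v: "v \<in> verts G"
    show "h (c v) v \<in> edges G \<union> {{}}" using h(1)[OF cv[OF v]] by simp
    show "v \<in> h (c v) v" if "h (c v) v \<noteq> {}" using h(1)[OF cv[OF v]] that by simp
  qed
  then show ?thesis
  proof (rule chromatic_number1_leI[OF G _ c(1)])
    fix u v assume e: "{u, v} \<in> edges G" "c u = c v"
    have "{u, v} \<in> {e \<in> edges G. e \<subseteq> {v \<in> verts G. c v = c u}}"
      using e edge_endpoints[OF G e(1)] by simp
    then have "{u, v} \<in> h (c u) ` {v \<in> verts G. c v = c u}"
      by (rule subsetD[OF h(2)[OF cv[OF edge_endpoints(2)[OF G e(1)]]]])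
    then show "{u, v} \<in> (\<lambda>v. h (c v) v) ` verts G" by force
  qed
qed

text \<open>The graph \<open>H\<close> of removed edges splits into two induced forests. Inside a
  class of the combined colouring all edges of \<open>G\<close> are monochromatic for
  \<open>c\<close>, hence removed, hence edges of one of these forests.\<close>

lemma vertex_arboricity_le_two_chromatic_number1:
  assumes G: "simple_graph G"
  shows "vertex_arboricity G \<le> 2 * chromatic_number1 G"
proof -
  obtain f c where f: "one_selection G f" and c: "c \<in> verts G \<rightarrow> {..<chromatic_number1 G}"
    "\<And>u v. {u, v} \<in> edges G \<Longrightarrow> c u = c v \<Longrightarrow> {u, v} \<in> f ` verts G"
    using chromatic_number1_leE[OF G order_refl] by blast
  define H where "H = \<lparr>verts = verts G, edges = edges G \<inter> f ` verts G\<rparr>"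
  have H: "simple_graph H" using G by (auto simp: H_def simple_graph_def)
  have "\<exists>b\<in>verts G \<rightarrow> {..<(2::nat) div 2 + 1}. \<forall>i. is_forest (induced_subgraph H {v \<in> verts G. b v = i})"
    by (rule degenerate_forest_colouring[OF H finite_verts[OF G]])
      (use selection_two_degenerate[OF G f] in \<open>simp add: H_def\<close>)
  then have "\<exists>b\<in>verts G \<rightarrow> {..<2::nat}. \<forall>i. is_forest (induced_subgraph H {v \<in> verts G. b v = i})"
    by (simp add: numeral_2_eq_2)
  then obtain b where b1: "b \<in> verts G \<rightarrow> {..<2::nat}"
    and b2: "\<forall>i. is_forest (induced_subgraph H {v \<in> verts G. b v = i})" by (elim bexE) (rule that)
  show ?thesis
  proof (rule vertex_arboricity_leI)
    show "(\<lambda>v. 2 * c v + b v) \<in> verts G \<rightarrow> {..<2 * chromatic_number1 G}"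
    proof
      fix v assume v: "v \<in> verts G"
      have "c v < chromatic_number1 G" "b v < 2" using v b1 c(1) by auto
      then show "2 * c v + b v \<in> {..<2 * chromatic_number1 G}"
        using product_colour_bound by simp
    qed
    fix i
    have dm: "c v = i div 2 \<and> b v = i mod 2" if "v \<in> verts G" "2 * c v + b v = i" for v
    proof -
      have "b v < 2" using that b1 by auto
      then show ?thesis using that(2) by auto
    qed
    show "is_forest (induced_subgraph G {v \<in> verts G. 2 * c v + b v = i})"
    proof (rule is_forest_mono[OF spec[OF b2, of "i mod 2"]], rule subsetI)
      fix e assume "e \<in> edges (induced_subgraph G {v \<in> verts G. 2 * c v + b v = i})"
      then have e: "e \<in> edges G" "\<And>v. v \<in> e \<Longrightarrow> v \<in> verts G \<and> c v = i div 2 \<and> b v = i mod 2"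
        using dm by auto
      obtain u v where uv: "e = {u, v}" using edgeE[OF G e(1)] by blast
      then have "e \<in> f ` verts G" using c(2) e by simp
      then show "e \<in> edges (induced_subgraph H {v \<in> verts G. b v = i mod 2})"
        using e by (auto simp: H_def)
    qed
  qed
qed

lemma chromatic_number1_degenerate:
  assumes "simple_graph G" "degenerate d G"
  shows "chromatic_number1 G \<le> d div 2 + 1"
  using chromatic_number1_le_vertex_arboricity[OF assms(1)] vertex_arboricity_degenerate[OF assms]
  by simp

section \<open>Maximum degree\<close>

lemma degree_le_max_degree: "simple_graph G \<Longrightarrow> v \<in> verts G \<Longrightarrow> degree G v \<le> max_degree G"
  unfolding max_degree_def using finite_verts by (intro Max_ge) auto

lemma min_degree_le_degree: "simple_graph G \<Longrightarrow> v \<in> verts G \<Longrightarrow> min_degree G \<le> degree G v"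
  unfolding min_degree_def using finite_verts by (intro Min_le) auto

text \<open>A vertex of degree below \<open>3 * k\<close> sends at most 2 edges to some colour. With
  three monochromatic edges it could be recoloured to their advantage, so in an optimal colouring
  these edges have maximum degree 2 and can all be selected.\<close>

lemma max_degree_less_chromatic_number1:
  fixes k :: nat
  assumes G: "simple_graph G" and D: "max_degree G < 3 * k"
  shows "chromatic_number1 G \<le> k"
proof -
  define mono_edges where "mono_edges c = {e \<in> edges G. \<exists>i. \<forall>u\<in>e. c u = (i::nat)}" for c
  have fin: "finite (edges G)" by (rule finite_edges[OF G])
  have "k > 0" using D by simp
  then have "(\<lambda>_. 0) \<in> verts G \<rightarrow> {..<k}" by auto
  then obtain c where c: "c \<in> verts G \<rightarrow> {..<k}"
    "\<And>c'. c' \<in> verts G \<rightarrow> {..<k} \<Longrightarrow> card (mono_edges c) \<le> card (mono_edges c')"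
    using ex_has_least_nat[of "\<lambda>c. c \<in> verts G \<rightarrow> {..<k}" _ "\<lambda>c. card (mono_edges c)"] by blast
  have "card {e \<in> mono_edges c. v \<in> e} \<le> 2" for v
  proof (cases "v \<in> verts G")
    case False
    then have "{e \<in> mono_edges c. v \<in> e} = {}" using edge_subset_verts[OF G] unfolding mono_edges_def by blast
    then show ?thesis by (metis card.empty le0)
  next
    case True
    \<comment> \<open>The edges at \<open>v\<close> that would be monochromatic if \<open>v\<close>
      had colour \<open>i\<close>.\<close>
    define N where "N i = {e \<in> edges G. v \<in> e \<and> (\<forall>u\<in>e - {v}. c u = i)}" for i
    have "N i \<inter> N j = {}" if "i \<noteq> j" for i j
    proof (rule ccontr)
      assume "N i \<inter> N j \<noteq> {}"
      then obtain e where e: "e \<in> N i" "e \<in> N j" by blast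
      then obtain u where "e = {v, u}" "u \<noteq> v" using edge_other_end[OF G, of e v] by (auto simp: N_def)
      then show False using e that by (auto simp: N_def)
    qed
    then have "(\<Sum>i<k. card (N i)) = card (\<Union>i<k. N i)"
      using fin by (subst card_UN_disjoint) (auto simp: N_def)
    also have "\<dots> \<le> card {e \<in> edges G. v \<in> e}"
      using fin by (intro card_mono) (auto simp: N_def)
    also have "\<dots> < 3 * k" using degree_le_max_degree[OF G True] D by (simp add: degree_def)
    finally have sum: "(\<Sum>i<k. card (N i)) < 3 * k" .
    have "\<exists>i<k. card (N i) \<le> 2"
    proof (rule ccontr)
      assume "\<not> ?thesis"
      then have "(\<Sum>i<k. 3) \<le> (\<Sum>i<k. card (N i))" by (intro sum_mono) force
      then show False using sum by simp
    qed
    then obtain i where i: "i < k" "card (N i) \<le> 2" by blast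
    have at_v: "{e \<in> mono_edges c'. v \<in> e} = {e \<in> edges G. v \<in> e \<and> (\<forall>u\<in>e - {v}. c' u = c' v)}" for c'
      unfolding mono_edges_def by auto
    have split: "card (mono_edges c') = card {e \<in> mono_edges c'. v \<notin> e} + card {e \<in> mono_edges c'. v \<in> e}" for c'
    proof -
      have "mono_edges c' = {e \<in> mono_edges c'. v \<notin> e} \<union> {e \<in> mono_edges c'. v \<in> e}" by blast
      moreover have "card ({e \<in> mono_edges c'. v \<notin> e} \<union> {e \<in> mono_edges c'. v \<in> e})
          = card {e \<in> mono_edges c'. v \<notin> e} + card {e \<in> mono_edges c'. v \<in> e}"
        using fin by (intro card_Un_disjoint) (auto simp: mono_edges_def)
      ultimately show ?thesis by simp
    qed
    have "{e \<in> mono_edges (c(v := i)). v \<notin> e} = {e \<in> mono_edges c. v \<notin> e}"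
      unfolding mono_edges_def by (auto; metis fun_upd_other)
    moreover have "{e \<in> mono_edges (c(v := i)). v \<in> e} = N i"
      unfolding at_v N_def by auto
    moreover have "card (mono_edges c) \<le> card (mono_edges (c(v := i)))"
      using c(1) i(1) by (intro c(2)) auto
    ultimately show ?thesis using split[of c] split[of "c(v := i)"] i(2) by simp
  qed
  moreover have "mono_edges c \<subseteq> edges G" by (auto simp: mono_edges_def)
  ultimately obtain f where f: "one_selection G f" "mono_edges c \<subseteq> f ` verts G"
    using max_degree_two_selection[OF G, of "mono_edges c"] by blast
  show ?thesis
  proof (rule chromatic_number1_leI[OF G f(1) c(1)])
    fix u v assume "{u, v} \<in> edges G" "c u = c v"
    then have "{u, v} \<in> mono_edges c" by (auto simp: mono_edges_def)
    then show "{u, v} \<in> f ` verts G" using f(2) by blast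
  qed
qed

section \<open>Chromatic index\<close>

lemma edge_colouring_degree:
  assumes G: "simple_graph G" and c: "proper_edge_colouring G k c" and F: "F \<subseteq> edges G"
  shows "card {e \<in> F. v \<in> e} = card (c ` {e \<in> F. v \<in> e})"
proof -
  have "inj_on c {e \<in> F. v \<in> e}"
    using c F unfolding proper_edge_colouring_def inj_on_def by blast
  then show ?thesis by (simp add: card_image)
qed

lemma degree_le_chromatic_index:
  assumes G: "simple_graph G"
  shows "degree G v \<le> chromatic_index G"
proof -
  obtain c where c: "proper_edge_colouring G (chromatic_index G) c"
    using chromatic_index_le_iff[OF G] by blast
  have "c ` {e \<in> edges G. v \<in> e} \<subseteq> {..<chromatic_index G}"
    using c unfolding proper_edge_colouring_def by blast
  then have "card (c ` {e \<in> edges G. v \<in> e}) \<le> chromatic_index G"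
    using card_mono[of "{..<chromatic_index G}"] by fastforce
  then show ?thesis using edge_colouring_degree[OF G c order_refl] by (simp add: degree_def)
qed

lemma max_degree_le_chromatic_index:
  assumes G: "simple_graph G"
  shows "max_degree G \<le> chromatic_index G"
  unfolding max_degree_def using G degree_le_chromatic_index[OF G]
  by (subst Max_le_iff) (auto simp: simple_graph_def)

lemma chromatic_index1_le_chromatic_index:
  assumes G: "simple_graph G" and D: "max_degree G > 1"
  shows "chromatic_index1 G + 2 \<le> chromatic_index G"
proof -
  define k where "k = chromatic_index G"
  have k: "2 \<le> k" using max_degree_le_chromatic_index[OF G] D by (simp add: k_def)
  obtain c where c: "proper_edge_colouring G k c"
    using chromatic_index_le_iff[OF G] k_def by blast
  \<comment> \<open>The last two colours. The maximum degree above 1 gives \<open>2 \<le> k\<close>,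
    so the subtraction is not truncated.\<close>
  define F where "F = {e \<in> edges G. k - 2 \<le> c e}"
  have "card {e \<in> F. v \<in> e} \<le> 2" for v
  proof -
    have "c ` {e \<in> F. v \<in> e} \<subseteq> {k - 2..<k}"
      using c unfolding F_def proper_edge_colouring_def by auto
    then have "card (c ` {e \<in> F. v \<in> e}) \<le> card {k - 2..<k}" by (intro card_mono) auto
    then show ?thesis using edge_colouring_degree[OF G c, of F v] k by (simp add: F_def)
  qed
  then obtain f where f: "one_selection G f" "F \<subseteq> f ` verts G"
    using max_degree_two_selection[OF G, of F] by (auto simp: F_def)
  have "proper_edge_colouring (one_removed G f) (k - 2) c"
    unfolding proper_edge_colouring_def edges_one_removed
  proof (intro conjI ballI impI Pi_I)
    show "c e \<in> {..<k - 2}" if "e \<in> edges G - f ` verts G" for e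
      using that f(2) by (auto simp: F_def)
    show "c e \<noteq> c e'" if "e \<in> edges G - f ` verts G" "e' \<in> edges G - f ` verts G"
      "e \<noteq> e' \<and> e \<inter> e' \<noteq> {}" for e e'
      using that c unfolding proper_edge_colouring_def by blast
  qed
  then have "chromatic_index (one_removed G f) \<le> k - 2"
    using chromatic_index_le_iff[OF simple_graph_one_removed[OF G]] by blast
  then show ?thesis using chromatic_index1_le[OF G f(1)] k unfolding k_def by linarith
qed

theorem vizing:
  assumes G: "simple_graph G"
  shows "chromatic_index G \<le> max_degree G + 1"
proof -
  let ?k = "max_degree G + 1"
  have "card {e \<in> edges G. v \<in> e} < ?k" for v
  proof (cases "v \<in> verts G")
    case True
    then show ?thesis using degree_le_max_degree[OF G True] by (simp add: degree_def)
  next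
    case False
    then have "{e \<in> edges G. v \<in> e} = {}" using edge_subset_verts[OF G] by blast
    then have "card {e \<in> edges G. v \<in> e} = 0" by (simp only: card.empty)
    then show ?thesis by simp
  qed
  then obtain M where M: "matching_family (edges G) ?k M" "covers (edges G) ?k M"
    using vizing_matching_family[of "edges G" ?k] finite_edges[OF G] card_edge[OF G] by blast
  define c where "c e = (SOME i. i < ?k \<and> (\<exists>v\<in>e. e = {v, M i v}))" for e
  have c: "c e < ?k \<and> (\<exists>v\<in>e. e = {v, M (c e) v})" if e: "e \<in> edges G" for e
  proof -
    obtain u v where "e = {u, v}" "u \<noteq> v" using edgeE[OF G e] by blast
    then have "\<exists>i. i < ?k \<and> (\<exists>v\<in>e. e = {v, M i v})"
      using M(2) e unfolding covers_def by blast
    then show ?thesis unfolding c_def by (rule someI_ex)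
  qed
  \<comment> \<open>An edge is determined by its colour and either of its ends, so edges of equal
    colour meeting in \<open>w\<close> coincide.\<close>
  have edge: "e = {w, M (c e) w}" if e: "e \<in> edges G" "w \<in> e" for e w
  proof -
    obtain v where v: "e = {v, M (c e) v}" "c e < ?k" using c[OF e(1)] by blast
    then show ?thesis
      using matching_familyD(1)[OF M(1) v(2)] e(2) by (metis doubleton_eq_iff insert_iff singletonD)
  qed
  have "proper_edge_colouring G ?k c"
    unfolding proper_edge_colouring_def
  proof (intro conjI ballI impI Pi_I)
    show "c e \<in> {..<?k}" if "e \<in> edges G" for e using c[OF that] by simp
    fix e e' assume e: "e \<in> edges G" "e' \<in> edges G" "e \<noteq> e' \<and> e \<inter> e' \<noteq> {}"
    then obtain w where "w \<in> e" "w \<in> e'" by blast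
    then show "c e \<noteq> c e'" using edge[OF e(1)] edge[OF e(2)] e(3) by metis
  qed
  then show ?thesis using chromatic_index_le_iff[OF G] by blast
qed

text \<open>At most as many edges as vertices are removed, so the average degree drops by at most 2,
  and every remaining degree is bounded by the chromatic index of the removed subgraph.\<close>

lemma min_degree_le_chromatic_index1:
  assumes G: "simple_graph G"
  shows "min_degree G \<le> chromatic_index1 G + 2"
proof -
  obtain f where f: "one_selection G f" "chromatic_index1 G = chromatic_index (one_removed G f)"
    using chromatic_index1E[OF G] .
  let ?H = "one_removed G f" and ?n = "card (verts G)"
  have H: "simple_graph ?H" by (rule simple_graph_one_removed[OF G])
  have fin: "finite (verts G)" by (rule finite_verts[OF G])
  have sum_degree: "(\<Sum>v\<in>verts K. degree K v) = 2 * card (edges K)" if "simple_graph K" for K :: "'a graph"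
    unfolding degree_def using that edge_subset_verts[OF that] card_edge[OF that]
    by (intro handshake finite_verts finite_edges) auto
  have "?n * min_degree G = (\<Sum>v\<in>verts G. min_degree G)" by simp
  also have "\<dots> \<le> (\<Sum>v\<in>verts G. degree G v)" by (intro sum_mono min_degree_le_degree[OF G])
  also have "\<dots> = 2 * card (edges G)" by (rule sum_degree[OF G])
  also have "\<dots> \<le> 2 * card (edges ?H) + 2 * card (f ` verts G)"
    using diff_card_le_card_Diff[of "f ` verts G" "edges G"] fin by simp
  also have "\<dots> \<le> (\<Sum>v\<in>verts G. degree ?H v) + 2 * ?n"
    using sum_degree[OF H] card_image_le[OF fin, of f] by simp
  also have "\<dots> \<le> (\<Sum>v\<in>verts G. chromatic_index1 G) + 2 * ?n"
    using degree_le_chromatic_index[OF H] f(2) by (intro add_right_mono sum_mono) simp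
  finally have "?n * min_degree G \<le> ?n * (chromatic_index1 G + 2)" by (simp add: algebra_simps)
  moreover have "?n > 0" using G fin by (auto simp: simple_graph_def card_gt_0_iff)
  ultimately show ?thesis by (simp only: nat_mult_le_cancel1)
qed

section \<open>Extremal examples\<close>

definition complete_graph :: "nat \<Rightarrow> nat graph" where
  "complete_graph n = \<lparr>verts = {..<n}, edges = [{..<n}]\<^bsup>2\<^esup>\<rparr>"

lemma verts_complete_graph [simp]: "verts (complete_graph n) = {..<n}"
  and edges_complete_graph [simp]: "edges (complete_graph n) = [{..<n}]\<^bsup>2\<^esup>"
  by (simp_all add: complete_graph_def)

lemma simple_complete_graph: "n \<ge> 1 \<Longrightarrow> simple_graph (complete_graph n)"
  unfolding simple_graph_def by (auto simp: lessThan_empty_iff)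

lemma degree_complete_graph:
  assumes "v < n" shows "degree (complete_graph n) v = n - 1"
proof -
  have "{e \<in> [{..<n}]\<^bsup>2\<^esup>. v \<in> e} = (\<lambda>u. {v, u}) ` ({..<n} - {v})"
    using assms by (auto simp: nsets_def card_2_iff insert_commute)
  moreover have "inj_on (\<lambda>u. {v, u}) ({..<n} - {v})"
    by (auto simp: inj_on_def doubleton_eq_iff)
  ultimately show ?thesis
    using assms by (simp add: degree_def card_image)
qed

lemma max_degree_complete_graph:
  assumes "n \<ge> 1" shows "max_degree (complete_graph n) = n - 1"
proof -
  have "degree (complete_graph n) ` {..<n} = {n - 1}"
    using assms degree_complete_graph by (auto simp: image_iff intro!: exI[of _ 0])
  then show ?thesis by (simp add: max_degree_def)
qed

lemma min_degree_complete_graph: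
  assumes "n \<ge> 1" shows "min_degree (complete_graph n) = n - 1"
proof -
  have "degree (complete_graph n) ` {..<n} = {n - 1}"
    using assms degree_complete_graph by (auto simp: image_iff intro!: exI[of _ 0])
  then show ?thesis by (simp add: min_degree_def)
qed

lemma numbers_complete_graph:
  assumes n: "n \<ge> 1"
  shows "clique_number (complete_graph n) = n" "chromatic_number (complete_graph n) = n"
proof -
  note G = simple_complete_graph[OF n]
  have "is_clique (complete_graph n) {..<n}"
    by (auto simp: is_clique_def clique_def)
  then have "n \<le> clique_number (complete_graph n)" using clique_number_ge[OF G] by fastforce
  moreover have "proper_colouring (complete_graph n) n (\<lambda>v. v)"
    using edge_endpoints[OF G] unfolding proper_colouring_def by auto
  then have "chromatic_number (complete_graph n) \<le> n" using chromatic_number_le_iff[OF G] by blast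
  ultimately show "clique_number (complete_graph n) = n" "chromatic_number (complete_graph n) = n"
    using clique_number_le_chromatic_number[OF G] by simp_all
qed

lemma clique_number1_le_chromatic_number1:
  assumes G: "simple_graph G" shows "clique_number1 G \<le> chromatic_number1 G"
proof -
  obtain f where f: "one_selection G f" "chromatic_number1 G = chromatic_number (one_removed G f)"
    using chromatic_number1E[OF G] .
  have "clique_number1 G \<le> clique_number (one_removed G f)" by (rule clique_number1_le[OF G f(1)])
  also have "\<dots> \<le> chromatic_number1 G"
    using clique_number_le_chromatic_number[OF simple_graph_one_removed[OF G]] f(2) by simp
  finally show ?thesis .
qed

text \<open>The value is n/3 rounded up. The degree bound gives it as an upper bound for
  \<open>chromatic_number1\<close>, the factor 3 as a lower bound for the smaller
  \<open>clique_number1\<close>.\<close>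

lemma numbers1_complete_graph:
  assumes n: "n \<ge> 1"
  shows "chromatic_number1 (complete_graph n) = (n + 2) div 3"
    "clique_number1 (complete_graph n) = (n + 2) div 3"
proof -
  note G = simple_complete_graph[OF n]
  have "max_degree (complete_graph n) < 3 * ((n + 2) div 3)"
    using n max_degree_complete_graph[OF n] by simp
  then have "chromatic_number1 (complete_graph n) \<le> (n + 2) div 3"
    by (rule max_degree_less_chromatic_number1[OF G])
  moreover have "n \<le> 3 * clique_number1 (complete_graph n)"
    using clique_number_le_three_clique_number1[OF G] numbers_complete_graph[OF n] by simp
  ultimately show "chromatic_number1 (complete_graph n) = (n + 2) div 3"
      "clique_number1 (complete_graph n) = (n + 2) div 3"
    using clique_number1_le_chromatic_number1[OF G] by linarith+
qed

lemma ceiling_third: "\<lceil>real n / 3\<rceil> = int ((n + 2) div 3)"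
proof (rule ceiling_unique)
  define q where "q = (n + 2) div 3"
  have "3 * q \<le> n + 2" "n \<le> 3 * q" unfolding q_def by linarith+
  then show "of_int (int ((n + 2) div 3)) - 1 < real n / 3" "real n / 3 \<le> of_int (int ((n + 2) div 3))"
    unfolding q_def[symmetric] by linarith+
qed

section \<open>Complete multipartite graphs and lines\<close>

definition complete_multipartite_graph :: "nat \<Rightarrow> nat \<Rightarrow> nat graph" where
  "complete_multipartite_graph k n =
     \<lparr>verts = {..<n}, edges = {{u, v} | u v. u < n \<and> v < n \<and> u mod k \<noteq> v mod k}\<rparr>"

lemma complete_multipartite_edge_iff:
  "{u, v} \<in> edges (complete_multipartite_graph k n) \<longleftrightarrow> u < n \<and> v < n \<and> u mod k \<noteq> v mod k"
  by (auto simp: complete_multipartite_graph_def doubleton_eq_iff)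

lemma simple_complete_multipartite_graph:
  assumes "n \<ge> 1" shows "simple_graph (complete_multipartite_graph k n)"
  using assms unfolding simple_graph_def complete_multipartite_graph_def
  by (auto simp: lessThan_empty_iff)

text \<open>Two points determine a line. Hence an edge lies on at most one line, and a removed edge
  destroys at most one of the cliques.\<close>

lemma lines_meet_once:
  fixes a b a' b' i j :: nat
  assumes "a + i * b = a' + i * b'" "a + j * b = a' + j * b'" "i \<noteq> j"
  shows "a = a' \<and> b = b'"
proof -
  have "int a + int i * int b = int a' + int i * int b'" "int a + int j * int b = int a' + int j * int b'"
    using assms(1,2) by (metis of_nat_add of_nat_mult)+
  then have "(int i - int j) * (int b - int b') = 0" by (simp add: algebra_simps)
  then have "b = b'" using assms(3) by simp
  then show ?thesis using assms(1) by simp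
qed

text \<open>
  The vertex \<open>x * k + i\<close> stands for the point \<open>(i, x)\<close>, and its class is \<open>i\<close>. The lines
  \<open>x = a + i * b\<close> carry pairwise edge-disjoint cliques of size \<open>k\<close>, and there are more
  of them than vertices.
\<close>

lemma complete_multipartite_clique_survives:
  fixes k :: nat
  assumes k: "k \<ge> 1"
  defines "n \<equiv> 2 * k * k * (2 * k + 1)"
  defines "G \<equiv> complete_multipartite_graph k n"
  assumes f: "one_selection G f"
  shows "k \<le> clique_number (one_removed G f)"
proof (rule ccontr)
  assume small: "\<not> ?thesis"
  \<comment> \<open>There are \<open>B\<close> slopes and \<open>k * B\<close> intercepts. The
    heights \<open>a + i * b\<close> stay below \<open>2 * k * B\<close>, which is the class size in
    \<open>n\<close>; the \<open>k * B * B\<close> lines outnumber the \<open>2 * k * k * B\<close>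
    vertices because \<open>B\<close> exceeds \<open>2 * k\<close>.\<close>
  define B where "B = 2 * k + 1"
  define p where "p a b i = (a + i * b) * k + i" for a b i :: nat
  define L where "L a b = p a b ` {..<k}" for a b
  have "n \<ge> 1" using k by (simp add: n_def Suc_le_eq)
  then have G: "simple_graph G" unfolding G_def by (rule simple_complete_multipartite_graph)
  have pmod: "p a b i mod k = i" and pdiv: "p a b i div k = a + i * b" if "i < k" for a b i
    using that by (simp_all add: p_def)
  have pn: "p a b i < n" if "a < k * B" "b < B" "i < k" for a b i
  proof -
    have "i * b \<le> k * B" using that by (intro mult_le_mono) auto
    then have "a + i * b + 1 \<le> 2 * k * B" using that(1) by simp
    then have "(a + i * b + 1) * k \<le> 2 * k * B * k" by (rule mult_le_mono1)
    moreover have "p a b i < (a + i * b + 1) * k" using that(3) by (simp add: p_def)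
    ultimately show ?thesis by (simp add: n_def B_def mult_ac)
  qed
  have ex: "\<exists>i<k. \<exists>j<k. i \<noteq> j \<and> {p a b i, p a b j} \<in> f ` verts G" if ab: "a < k * B" "b < B" for a b
  proof (rule ccontr)
    assume no: "\<not> ?thesis"
    have "is_clique (one_removed G f) (L a b)"
      unfolding is_clique_def clique_def
    proof (intro conjI ballI impI)
      show "L a b \<subseteq> verts (one_removed G f)"
        using pn[OF ab] by (auto simp: L_def G_def complete_multipartite_graph_def)
      fix u v assume "u \<in> L a b" "v \<in> L a b" "u \<noteq> v"
      then obtain i j where ij: "i < k" "j < k" "i \<noteq> j" "u = p a b i" "v = p a b j"
        by (auto simp: L_def)
      then have "{u, v} \<in> edges G"
        unfolding G_def complete_multipartite_edge_iff using pn[OF ab] pmod by simp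
      moreover have "{u, v} \<notin> f ` verts G" using no ij by blast
      ultimately show "{u, v} \<in> edges (one_removed G f)" by simp
    qed
    moreover have "card (L a b) = k"
    proof -
      have "inj_on (p a b) {..<k}" using pmod by (metis inj_onI lessThan_iff)
      then show ?thesis by (simp add: L_def card_image)
    qed
    ultimately show False
      using clique_number_ge[OF simple_graph_one_removed[OF G]] small by metis
  qed
  define Q where "Q a b e \<longleftrightarrow> (\<exists>i<k. \<exists>j<k. i \<noteq> j \<and> e = {p a b i, p a b j} \<and> e \<in> f ` verts G)"
    for a b e
  \<comment> \<open>One removed edge is chosen on every line; distinct lines get distinct
    edges.\<close>
  define g where "g = (\<lambda>(a, b). SOME e. Q a b e)"
  have g: "\<exists>i<k. \<exists>j<k. i \<noteq> j \<and> g (a, b) = {p a b i, p a b j} \<and> g (a, b) \<in> f ` verts G"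
    if "a < k * B" "b < B" for a b
  proof -
    have "\<exists>e. Q a b e" using ex[OF that] unfolding Q_def by blast
    then have "Q a b (g (a, b))" unfolding g_def prod.case by (rule someI_ex)
    then show ?thesis by (simp only: Q_def)
  qed
  have "inj_on g ({..<k * B} \<times> {..<B})"
  proof (rule inj_onI)
    fix z z' assume z: "z \<in> {..<k * B} \<times> {..<B}" "z' \<in> {..<k * B} \<times> {..<B}" "g z = g z'"
    obtain a b a' b' where ab: "z = (a, b)" "z' = (a', b')" by (metis surj_pair)
    then have *: "a < k * B" "b < B" "a' < k * B" "b' < B" and eq: "g (a, b) = g (a', b')"
      using z by auto
    obtain i j where ij: "i < k" "j < k" "i \<noteq> j" "g (a, b) = {p a b i, p a b j}"
      using g[of a b] * by auto
    obtain i' j' where ij': "i' < k" "j' < k" "g (a, b) = {p a' b' i', p a' b' j'}"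
      using g[of a' b'] * eq by auto
    have on_line: "a + i * b = a' + i * b'" if "i < k" "p a b i \<in> {p a' b' i', p a' b' j'}" for i
      using that ij'(1,2) pmod[of _ a b] pmod[of _ a' b'] pdiv[of _ a b] pdiv[of _ a' b']
      by (metis insertE singletonD)
    have "p a b i \<in> {p a' b' i', p a' b' j'}" "p a b j \<in> {p a' b' i', p a' b' j'}"
      using ij(4) ij'(3) by blast+
    then have "a = a' \<and> b = b'"
      by (intro lines_meet_once[OF on_line[OF ij(1)] on_line[OF ij(2)] ij(3)])
    then show "z = z'" using ab by simp
  qed
  moreover have "g ` ({..<k * B} \<times> {..<B}) \<subseteq> f ` verts G"
    using g by force
  moreover have "finite (verts G)" by (rule finite_verts[OF G])
  ultimately have "card ({..<k * B} \<times> {..<B}) \<le> card (f ` verts G)"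
    by (intro card_inj_on_le) auto
  also have "\<dots> \<le> card (verts G)" by (rule card_image_le) fact
  also have "\<dots> = n" by (simp add: G_def complete_multipartite_graph_def)
  also have "n = k * B * (2 * k)" by (simp only: n_def B_def mult_ac)
  finally have "k * B * B \<le> k * B * (2 * k)" by (simp only: card_cartesian_product card_lessThan)
  moreover have "k * B * (2 * k) < k * B * B"
    using k by (intro mult_less_mono2) (simp_all add: B_def)
  ultimately show False by simp
qed

text \<open>All four numbers lie between \<open>clique_number1 G\<close>, at least \<open>k\<close>
  by the survival of a clique, and \<open>chromatic_number G\<close>, at most \<open>k\<close> by
  the colouring modulo \<open>k\<close>.\<close>

lemma complete_multipartite_numbers:
  fixes k :: nat
  assumes k: "k \<ge> 1"
  defines "G \<equiv> complete_multipartite_graph k (2 * k * k * (2 * k + 1))"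
  shows "simple_graph G" "chromatic_number G = k" "clique_number G = k"
    "chromatic_number1 G = k" "clique_number1 G = k"
proof -
  show G: "simple_graph G"
    unfolding G_def by (rule simple_complete_multipartite_graph) (use k in \<open>simp add: Suc_le_eq\<close>)
  have "k \<le> clique_number1 G"
  proof -
    obtain f where f: "one_selection G f" "clique_number1 G = clique_number (one_removed G f)"
      using clique_number1E[OF G] .
    show ?thesis using complete_multipartite_clique_survives[OF k f(1)[unfolded G_def]] f(2)
      by (simp add: G_def)
  qed
  moreover have "proper_colouring G k (\<lambda>v. v mod k)"
    unfolding proper_colouring_def G_def complete_multipartite_edge_iff using k by auto
  then have "chromatic_number G \<le> k" using chromatic_number_le_iff[OF G] by blast
  ultimately show "chromatic_number G = k" "clique_number G = k"
    "chromatic_number1 G = k" "clique_number1 G = k"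
    using clique_number1_le_chromatic_number1[OF G] chromatic_number1_le_chromatic_number[OF G]
      clique_number1_le_clique_number[OF G] clique_number_le_chromatic_number[OF G] by linarith+
qed

section \<open>Small complete graphs\<close>

lemma triangle_removable:
  obtains f where "one_selection (complete_graph 3) f" "edges (one_removed (complete_graph 3) f) = {}"
proof -
  have G: "simple_graph (complete_graph 3)" by (rule simple_complete_graph) simp
  have "card {e \<in> edges (complete_graph 3). v \<in> e} \<le> 2" for v
  proof (cases "v < 3")
    case True
    then show ?thesis using degree_complete_graph[of v 3] by (simp add: degree_def)
  next
    case False
    then have "{e \<in> edges (complete_graph 3). v \<in> e} = {}"
      using edge_subset_verts[OF G] by auto
    then have "card {e \<in> edges (complete_graph 3). v \<in> e} = 0" by (simp only: card.empty)
    then show ?thesis by simp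
  qed
  from max_degree_two_selection[OF G order_refl this]
  obtain f where f: "one_selection (complete_graph 3) f"
    "edges (complete_graph 3) \<subseteq> f ` verts (complete_graph 3)" by blast
  then show thesis by (intro that[OF f(1)]) (simp only: edges_one_removed Diff_eq_empty_iff)
qed

lemma clique_cover_number1_triangle:
  "clique_cover_number1 (complete_graph 3) = 3 * clique_cover_number (complete_graph 3)"
proof -
  let ?G = "complete_graph 3"
  have G: "simple_graph ?G" by (rule simple_complete_graph) simp
  obtain f where f: "one_selection ?G f" "edges (one_removed ?G f) = {}" using triangle_removable .
  have "clique_cover_number ?G \<le> 1"
    unfolding clique_cover_number_def
    by (rule partition_of_colouring[of "\<lambda>_. 0"]) (auto simp: is_clique_def clique_def)
  moreover have "3 \<le> clique_cover_number (one_removed ?G f)"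
  proof -
    let ?k = "clique_cover_number (one_removed ?G f)"
    have "\<exists>c\<in>verts (one_removed ?G f) \<rightarrow> {..<?k}.
        \<forall>i<?k. is_clique (one_removed ?G f) {v \<in> verts (one_removed ?G f). c v = i}"
      by (rule colouring_of_partition[OF _ _ clique_cover_number_def])
        (auto simp: is_clique_def clique_def)
    then obtain c where c: "c \<in> {..<3} \<rightarrow> {..<?k}"
        "\<And>i. i < ?k \<Longrightarrow> is_clique (one_removed ?G f) {v \<in> {..<3}. c v = i}"
      by auto
    have "inj_on c {..<3}"
    proof (rule inj_onI, rule ccontr)
      fix u v :: nat assume uv: "u \<in> {..<3}" "v \<in> {..<3}" "c u = c v" "u \<noteq> v"
      then have "c u < ?k" using c(1) by auto
      from c(2)[OF this] have "{u, v} \<in> edges (one_removed ?G f)"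
        using uv unfolding is_clique_def clique_def by auto
      then show False using f(2) by blast
    qed
    then show ?thesis using card_inj_on_le[of c "{..<3}" "{..<?k}"] c(1) by auto
  qed
  ultimately show ?thesis
    using clique_cover_number1_ge[OF G f(1)] clique_cover_number1_le_three_clique_cover_number[OF G]
    by linarith
qed

lemma vertex_arboricity_triangle: "vertex_arboricity (complete_graph 3) = 2"
proof -
  let ?G = "complete_graph 3"
  have G: "simple_graph ?G" by (rule simple_complete_graph) simp
  have "chromatic_number1 ?G = 1" using numbers1_complete_graph(1)[of 3] by simp
  then have "vertex_arboricity ?G \<le> 2" "1 \<le> vertex_arboricity ?G"
    using vertex_arboricity_le_two_chromatic_number1[OF G] chromatic_number1_le_vertex_arboricity[OF G]
    by simp_all
  moreover have "vertex_arboricity ?G \<noteq> 1"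
  proof
    assume one: "vertex_arboricity ?G = 1"
    obtain c where c: "c \<in> verts ?G \<rightarrow> {..<vertex_arboricity ?G}"
      "\<And>i. i < vertex_arboricity ?G \<Longrightarrow> is_forest (induced_subgraph ?G {v \<in> verts ?G. c v = i})"
      using vertex_arboricityE[OF G] by blast
    have "{v \<in> verts ?G. c v = 0} = {..<3}" using c(1) one by auto
    then have "is_forest (induced_subgraph ?G {..<3})" using c(2)[of 0] one by simp
    moreover have "is_cycle (induced_subgraph ?G {..<3}) [0, 1, 2]"
      unfolding is_cycle_def
    proof (intro conjI allI impI)
      fix i :: nat assume "i < length [0, 1, 2 :: nat]"
      then consider "i = 0" | "i = 1" | "i = 2" by fastforce
      then show "{[0, 1, 2] ! i, [0, 1, 2] ! (Suc i mod length [0, 1, 2 :: nat])} \<in>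
          edges (induced_subgraph ?G {..<3})"
        by cases simp_all
    qed simp_all
    ultimately show False by (auto simp: is_forest_def)
  qed
  ultimately show ?thesis by linarith
qed

lemma vertex_arboricity_one_vertex: "vertex_arboricity (complete_graph 1) = 1"
proof -
  let ?G = "complete_graph 1"
  have G: "simple_graph ?G" by (rule simple_complete_graph) simp
  have "edges (induced_subgraph ?G {v \<in> verts ?G. 0 = i}) = {}" for i :: nat
  proof -
    have "\<not> e \<subseteq> {v \<in> verts ?G. 0 = i}" if "e \<in> edges ?G" for e
      using card_edge[OF G that] edge_subset_verts[OF G that] card_mono[of "{..<1::nat}" e] by simp
    then show ?thesis by (auto simp only: edges_induced_subgraph)
  qed
  then have "vertex_arboricity ?G \<le> 1"
    by (intro vertex_arboricity_leI[of "\<lambda>_. 0"] is_forest_no_edges) auto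
  moreover have "chromatic_number1 ?G = 1" using numbers1_complete_graph(1)[of 1] by simp
  ultimately show ?thesis using chromatic_number1_le_vertex_arboricity[OF G] by simp
qed

lemma chromatic_index1_triangle: "chromatic_index1 (complete_graph 3) = 0"
proof -
  let ?G = "complete_graph 3"
  have G: "simple_graph ?G" by (rule simple_complete_graph) simp
  obtain f where f: "one_selection ?G f" "edges (one_removed ?G f) = {}" using triangle_removable .
  have "proper_edge_colouring (one_removed ?G f) 0 (\<lambda>_. 0)"
    unfolding proper_edge_colouring_def f(2) by simp
  then have "chromatic_index (one_removed ?G f) \<le> 0"
    using chromatic_index_le_iff[OF simple_graph_one_removed[OF G]] by blast
  then show ?thesis using chromatic_index1_le[OF G f(1)] by simp
qed

text \<open>A colour class is a matching. The rounding down of half the vertex number is what gains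
  a colour for odd order.\<close>

lemma card_edges_le_chromatic_index:
  assumes G: "simple_graph G"
  shows "card (edges G) \<le> chromatic_index G * (card (verts G) div 2)"
proof -
  obtain c where c: "proper_edge_colouring G (chromatic_index G) c"
    using chromatic_index_le_iff[OF G] by blast
  define M where "M i = {e \<in> edges G. c e = i}" for i
  have M_le: "card (M i) \<le> card (verts G) div 2" for i
  proof -
    have "card {e \<in> M i. v \<in> e} \<le> 1" for v
    proof -
      have "c ` {e \<in> M i. v \<in> e} \<subseteq> {i}" by (auto simp: M_def)
      then have "card (c ` {e \<in> M i. v \<in> e}) \<le> card {i}" by (intro card_mono) auto
      moreover have "card {e \<in> M i. v \<in> e} = card (c ` {e \<in> M i. v \<in> e})"
        by (rule edge_colouring_degree[OF G c]) (auto simp: M_def)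
      ultimately show ?thesis by simp
    qed
    then have "(\<Sum>v\<in>verts G. card {e \<in> M i. v \<in> e}) \<le> (\<Sum>v\<in>verts G. 1)" by (intro sum_mono)
    moreover have "(\<Sum>v\<in>verts G. card {e \<in> M i. v \<in> e}) = 2 * card (M i)"
      using finite_verts[OF G] finite_edges[OF G] edge_subset_verts[OF G] card_edge[OF G]
      by (intro handshake) (auto simp: M_def)
    ultimately show ?thesis by simp
  qed
  have "edges G = (\<Union>i<chromatic_index G. M i)"
    using c by (auto simp: M_def proper_edge_colouring_def)
  then have "card (edges G) \<le> (\<Sum>i<chromatic_index G. card (M i))"
    using card_UN_le[of "{..<chromatic_index G}" M] by simp
  also have "\<dots> \<le> (\<Sum>i<chromatic_index G. card (verts G) div 2)" by (intro sum_mono M_le)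
  finally show ?thesis by simp
qed

text \<open>Of 10 edges at least 5 remain, and a matching on 5 vertices has at most 2, so three
  colours are needed. Vizing's bound 5 and the gap of 2 then force both values.\<close>

lemma chromatic_indices_K5:
  "chromatic_index (complete_graph 5) = 5" "chromatic_index1 (complete_graph 5) = 3"
proof -
  let ?G = "complete_graph 5"
  have G: "simple_graph ?G" by (rule simple_complete_graph) simp
  have D: "max_degree ?G = 4" using max_degree_complete_graph[of 5] by simp
  obtain f where f: "one_selection ?G f" "chromatic_index1 ?G = chromatic_index (one_removed ?G f)"
    using chromatic_index1E[OF G] .
  have "card (f ` verts ?G) \<le> 5" using card_image_le[of "{..<5}" f] by simp
  moreover have "card (edges ?G) = 10" by (simp add: card_nsets choose_two)
  ultimately have "5 \<le> card (edges (one_removed ?G f))"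
    using diff_card_le_card_Diff[of "f ` verts ?G" "edges ?G"] by simp
  also have "\<dots> \<le> chromatic_index1 ?G * 2"
    using card_edges_le_chromatic_index[OF simple_graph_one_removed[OF G], of f] f(2) by simp
  finally have "3 \<le> chromatic_index1 ?G" by simp
  then show "chromatic_index ?G = 5" "chromatic_index1 ?G = 3"
    using chromatic_index1_le_chromatic_index[OF G] vizing[OF G] D by simp_all
qed

section \<open>A universal degenerate graph\<close>

text \<open>
  An initial segment of a universal graph: every set of at most \<open>2 * k\<close> numbers is the set of
  smaller neighbours of infinitely many numbers.
\<close>

definition back_neighbours :: "nat \<Rightarrow> nat \<Rightarrow> nat set" where
  "back_neighbours k n = (let S = set_decode (fst (prod_decode n)) in
     if card S \<le> 2 * k \<and> (\<forall>s\<in>S. s < n) then S else {})"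

definition back_graph :: "nat \<Rightarrow> nat \<Rightarrow> nat graph" where
  "back_graph k N = \<lparr>verts = {..<N}, edges = {{m, n} | m n. n < N \<and> m \<in> back_neighbours k n}\<rparr>"

lemma back_neighboursD:
  shows "card (back_neighbours k n) \<le> 2 * k" "finite (back_neighbours k n)"
    "m \<in> back_neighbours k n \<Longrightarrow> m < n"
  by (auto simp: back_neighbours_def Let_def split: if_splits)

text \<open>The second component of the pair code is free, so it provides infinitely many codes of
  \<open>S\<close>; large values of it also put the code above every element of
  \<open>S\<close>.\<close>

lemma infinite_back_neighbours:
  assumes S: "finite S" "card S \<le> 2 * k"
  shows "infinite {n. n \<ge> N \<and> back_neighbours k n = S}"
proof -
  obtain b where b: "\<forall>s\<in>S. s < b" using S(1) finite_nat_set_iff_bounded by blast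
  define h where "h i = prod_encode (set_encode S, i)" for i
  have "h i \<ge> i" for i by (simp add: h_def le_prod_encode_2)
  note h_ge = this
  have "back_neighbours k (h i) = S \<and> N \<le> h i" if i: "i \<ge> max N b" for i
  proof
    have "set_decode (fst (prod_decode (h i))) = S" using S(1) by (simp add: h_def)
    moreover have "s < h i" if "s \<in> S" for s using b that i h_ge[of i] by fastforce
    ultimately show "back_neighbours k (h i) = S" using S(2) by (simp add: back_neighbours_def Let_def)
    show "N \<le> h i" using i h_ge[of i] by simp
  qed
  then have "h ` {max N b..} \<subseteq> {n. n \<ge> N \<and> back_neighbours k n = S}" by auto
  moreover have "inj_on h {max N b..}" by (auto simp: inj_on_def h_def prod_encode_eq)
  then have "infinite (h ` {max N b..})" using finite_imageD infinite_Ici by blast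
  ultimately show ?thesis using finite_subset by blast
qed

text \<open>Each of the finitely many sets \<open>S\<close> reaches \<open>M\<close> copies
  eventually, so one bound \<open>N'\<close> serves them all.\<close>

lemma back_neighbours_stage:
  "\<exists>N'\<ge>N. \<forall>S. S \<subseteq> {..<N} \<longrightarrow> card S \<le> 2 * k \<longrightarrow> M \<le> card {n \<in> {N..<N'}. back_neighbours k n = S}"
proof -
  have "\<forall>S\<in>Pow {..<N}. eventually (\<lambda>N'. card S \<le> 2 * k \<longrightarrow>
      M \<le> card {n \<in> {N..<N'}. back_neighbours k n = S}) sequentially"
  proof
    fix S assume "S \<in> Pow {..<N}"
    then have finS: "finite S" using finite_subset by blast
    show "eventually (\<lambda>N'. card S \<le> 2 * k \<longrightarrow>
      M \<le> card {n \<in> {N..<N'}. back_neighbours k n = S}) sequentially"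
    proof (cases "card S \<le> 2 * k")
      case True
      obtain B where B: "finite B" "card B = M" "B \<subseteq> {n. n \<ge> N \<and> back_neighbours k n = S}"
        using infinite_arbitrarily_large[OF infinite_back_neighbours[OF finS True, of N], where n = M]
        by (elim exE conjE) (rule that)
      obtain b where b: "\<forall>s\<in>B. s < b" using B(1) finite_nat_set_iff_bounded by blast
      have "M \<le> card {n \<in> {N..<N'}. back_neighbours k n = S}" if "N' \<ge> b" for N'
      proof -
        have "B \<subseteq> {n \<in> {N..<N'}. back_neighbours k n = S}" using B(3) b that by force
        then show ?thesis using B(2) card_mono[of "{n \<in> {N..<N'}. back_neighbours k n = S}" B] by simp
      qed
      then show ?thesis unfolding eventually_sequentially by blast
    qed simp
  qed
  then have "eventually (\<lambda>N'. \<forall>S\<in>Pow {..<N}. card S \<le> 2 * k \<longrightarrow>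
      M \<le> card {n \<in> {N..<N'}. back_neighbours k n = S}) sequentially"
    by (intro eventually_ball_finite) simp_all
  then have "eventually (\<lambda>N'. N' \<ge> N \<and> (\<forall>S\<in>Pow {..<N}. card S \<le> 2 * k \<longrightarrow>
      M \<le> card {n \<in> {N..<N'}. back_neighbours k n = S})) sequentially"
    by (intro eventually_conj eventually_ge_at_top)
  then obtain N' where "N' \<ge> N" "\<forall>S\<in>Pow {..<N}. card S \<le> 2 * k \<longrightarrow>
      M \<le> card {n \<in> {N..<N'}. back_neighbours k n = S}"
    unfolding eventually_sequentially by blast
  then show ?thesis by blast
qed

lemma simple_back_graph: "N \<ge> 1 \<Longrightarrow> simple_graph (back_graph k N)"
  unfolding simple_graph_def back_graph_def
  using back_neighboursD(3) by (fastforce simp: lessThan_empty_iff)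

text \<open>Inside \<open>W\<close> the largest vertex is joined only to its back
  neighbours.\<close>

lemma degenerate_back_graph: "degenerate (2 * k) (back_graph k N)"
  unfolding degenerate_def
proof (intro allI impI)
  fix W assume W: "W \<subseteq> verts (back_graph k N) \<and> W \<noteq> {}"
  then have fin: "finite W" by (auto simp: back_graph_def intro: finite_subset)
  define v where "v = Max W"
  have v: "v \<in> W" "\<And>u. u \<in> W \<Longrightarrow> u \<le> v" using fin W by (auto simp: v_def)
  have "{e \<in> edges (back_graph k N). e \<subseteq> W \<and> v \<in> e} \<subseteq> (\<lambda>m. {m, v}) ` back_neighbours k v"
  proof
    fix e assume e: "e \<in> {e \<in> edges (back_graph k N). e \<subseteq> W \<and> v \<in> e}"
    then obtain m n where mn: "e = {m, n}" "m \<in> back_neighbours k n" by (auto simp: back_graph_def)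
    then have "m < n" "n \<le> v" using back_neighboursD(3) v(2) e by auto
    then have "n = v" using e mn by auto
    then show "e \<in> (\<lambda>m. {m, v}) ` back_neighbours k v" using mn by blast
  qed
  then have "card {e \<in> edges (back_graph k N). e \<subseteq> W \<and> v \<in> e} \<le> card ((\<lambda>m. {m, v}) ` back_neighbours k v)"
    using back_neighboursD(2) by (intro card_mono) auto
  also have "\<dots> \<le> 2 * k"
    using card_image_le[OF back_neighboursD(2)] back_neighboursD(1) le_trans by blast
  finally show "min_degree (induced_subgraph (back_graph k N) W) \<le> 2 * k"
    using min_degree_induced_le_iff[OF fin, of "back_graph k N" "2 * k"] W v(1) by blast
qed

text \<open>The bound \<open>N0\<close> is fixed before the selection and the colouring, and
  \<open>N\<close> ranges over all larger segments; the induction needs this uniformity, since it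
  enlarges the graph before it knows which pairs repeat a colour.\<close>

definition forces_repeated_colours :: "nat \<Rightarrow> nat \<Rightarrow> nat \<Rightarrow> bool" where
  "forces_repeated_colours k j N0 \<longleftrightarrow> (\<forall>N f c. N0 \<le> N \<longrightarrow> one_selection (back_graph k N) f \<longrightarrow>
     c \<in> {..<N} \<rightarrow> {..<k} \<longrightarrow>
     (\<forall>u v. {u, v} \<in> edges (back_graph k N) \<longrightarrow> c u = c v \<longrightarrow> {u, v} \<in> f ` {..<N}) \<longrightarrow>
     (\<exists>J\<subseteq>{..<k}. card J = j \<and> (\<forall>i\<in>J. \<exists>u<N0. \<exists>v<N0. u \<noteq> v \<and> c u = i \<and> c v = i)))"

lemma forces_repeated_coloursD:
  assumes "forces_repeated_colours k j N0" "N0 \<le> N" "one_selection (back_graph k N) f"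
    "c \<in> {..<N} \<rightarrow> {..<k}"
    "\<And>u v. {u, v} \<in> edges (back_graph k N) \<Longrightarrow> c u = c v \<Longrightarrow> {u, v} \<in> f ` {..<N}"
  shows "\<exists>J\<subseteq>{..<k}. card J = j \<and> (\<forall>i\<in>J. \<exists>u<N0. \<exists>v<N0. u \<noteq> v \<and> c u = i \<and> c v = i)"
  using assms unfolding forces_repeated_colours_def by simp

text \<open>
  By induction on \<open>j\<close>, at least \<open>j\<close> colours occur twice. Given \<open>j\<close> such colours, take two
  vertices of each of them. Of the many vertices joined to exactly this set \<open>S\<close>, only those
  whose edge is selected by a vertex of \<open>S\<close> can carry one of these colours, so two of the
  remaining ones share a new colour.
\<close>

lemma back_graph_repeated_colours:
  "\<exists>N0. forces_repeated_colours k j N0"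
proof (induction j)
  case 0
  show ?case
    unfolding forces_repeated_colours_def by (intro exI[of _ 0] allI impI exI[of _ "{}"]) simp
next
  case (Suc j)
  then obtain N0 where N0: "forces_repeated_colours k j N0" by blast
  \<comment> \<open>Of the \<open>3 * k + 1\<close> copies at most \<open>2 * k\<close> can carry an
    old colour; the other \<open>k + 1\<close> exceed the number of colours.\<close>
  obtain N1 where N1: "N1 \<ge> N0" "\<And>S. S \<subseteq> {..<N0} \<Longrightarrow> card S \<le> 2 * k \<Longrightarrow>
      3 * k + 1 \<le> card {n \<in> {N0..<N1}. back_neighbours k n = S}"
    using back_neighbours_stage[of N0 k "3 * k + 1"] by blast
  have "\<exists>J\<subseteq>{..<k}. card J = Suc j \<and> (\<forall>i\<in>J. \<exists>u<N1. \<exists>v<N1. u \<noteq> v \<and> c u = i \<and> c v = i)"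
    if N: "N \<ge> N1" and f: "one_selection (back_graph k N) f" and c: "c \<in> {..<N} \<rightarrow> {..<k}"
      and mono: "\<forall>u v. {u, v} \<in> edges (back_graph k N) \<longrightarrow> c u = c v \<longrightarrow> {u, v} \<in> f ` {..<N}"
    for N f c
  proof -
    have "N \<ge> N0" using N N1(1) by simp
    from forces_repeated_coloursD[OF N0 this f c] mono obtain J where J: "J \<subseteq> {..<k}" "card J = j"
        "\<forall>i\<in>J. \<exists>u<N0. \<exists>v<N0. u \<noteq> v \<and> c u = i \<and> c v = i" by auto
    then obtain u v where uv: "\<And>i. i \<in> J \<Longrightarrow> u i < N0 \<and> v i < N0 \<and> u i \<noteq> v i \<and> c (u i) = i \<and> c (v i) = i"
      by metis
    have finJ: "finite J" and "j \<le> k"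
      using J finite_subset card_mono[of "{..<k}" J] by auto
    define S where "S = u ` J \<union> v ` J"
    have S: "S \<subseteq> {..<N0}" "finite S" using uv finJ by (auto simp: S_def)
    have "card S \<le> card (u ` J) + card (v ` J)" unfolding S_def by (rule card_Un_le)
    also have "\<dots> \<le> 2 * k" using card_image_le[OF finJ, of u] card_image_le[OF finJ, of v] J(2) \<open>j \<le> k\<close> by simp
    finally have cardS: "card S \<le> 2 * k" .
    define B where "B = {n \<in> {N0..<N1}. back_neighbours k n = S}"
    have finB: "finite B" by (simp add: B_def)
    \<comment> \<open>The edges from \<open>n\<close> to \<open>u i\<close> and \<open>v i\<close>
      are both monochromatic, hence both selected. As \<open>n\<close> selects only one, the other
      is selected by \<open>u i\<close> or \<open>v i\<close>; and each \<open>s\<close> in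
      \<open>S\<close> selects at most one edge.\<close>
    have "{n \<in> B. c n \<in> J} \<subseteq> (\<Union>s\<in>S. f s - {s})"
    proof
      fix n assume n: "n \<in> {n \<in> B. c n \<in> J}"
      define i where "i = c n"
      have i: "i \<in> J" "u i \<in> S" "v i \<in> S" using n by (auto simp: i_def S_def)
      have nN: "n < N" "N0 \<le> n" "back_neighbours k n = S" using n N by (auto simp: B_def)
      have "{w, n} \<in> f ` {..<N}" if "w \<in> S" "c w = i" for w
      proof -
        have "{w, n} \<in> edges (back_graph k N)" using that nN by (auto simp: back_graph_def)
        then show ?thesis using mono that(2) i_def by simp
      qed
      note selected = this
      have "{u i, n} \<in> f ` {..<N}" "{v i, n} \<in> f ` {..<N}"
        using selected[OF i(2)] selected[OF i(3)] uv[OF i(1)] by simp_all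
      then obtain a b where ab: "a < N" "b < N" "f a = {u i, n}" "f b = {v i, n}"
        unfolding image_iff by (metis lessThan_iff)
      have "x \<in> f x" if "x < N" "f x \<noteq> {}" for x
        using f that unfolding one_selection_def by (simp add: back_graph_def)
      from this[OF ab(1)] this[OF ab(2)] have "a \<in> {u i, n}" "b \<in> {v i, n}"
        using ab(3,4) by simp_all
      moreover have "\<not> (a = n \<and> b = n)" using ab uv[OF i(1)] by (auto simp: doubleton_eq_iff)
      moreover have "n \<noteq> u i" "n \<noteq> v i" using uv[OF i(1)] nN by auto
      ultimately have "n \<in> f (u i) - {u i} \<or> n \<in> f (v i) - {v i}" using ab by auto
      then show "n \<in> (\<Union>s\<in>S. f s - {s})" using i by blast
    qed
    moreover have fs: "finite (f s - {s}) \<and> card (f s - {s}) \<le> 1" if "s \<in> S" for s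
    proof -
      have sN: "s < N" using that S(1) N N1(1) by auto
      then have "f s = {} \<or> f s \<in> edges (back_graph k N) \<and> s \<in> f s"
        using f unfolding one_selection_def by (auto simp: back_graph_def)
      moreover have "simple_graph (back_graph k N)" using sN by (intro simple_back_graph) simp
      ultimately show ?thesis
        using card_edge[of "back_graph k N" "f s"] by (auto simp: card_2_iff)
    qed
    ultimately have "card {n \<in> B. c n \<in> J} \<le> card (\<Union>s\<in>S. f s - {s})"
      using S(2) by (intro card_mono) auto
    also have "\<dots> \<le> (\<Sum>s\<in>S. card (f s - {s}))" by (rule card_UN_le[OF S(2)])
    also have "\<dots> \<le> (\<Sum>s\<in>S. 1)" using fs by (intro sum_mono) blast
    finally have "card {n \<in> B. c n \<in> J} \<le> 2 * k" using cardS by simp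
    moreover have "3 * k + 1 \<le> card B" unfolding B_def by (rule N1(2)[OF S(1) cardS])
    moreover have "card B = card {n \<in> B. c n \<in> J} + card {n \<in> B. c n \<notin> J}"
    proof -
      have "B = {n \<in> B. c n \<in> J} \<union> {n \<in> B. c n \<notin> J}" by blast
      then show ?thesis using card_Un_disjoint[of "{n \<in> B. c n \<in> J}" "{n \<in> B. c n \<notin> J}"] finB by auto
    qed
    ultimately have "k < card {n \<in> B. c n \<notin> J}" by linarith
    moreover have "c ` {n \<in> B. c n \<notin> J} \<subseteq> {..<k}" using c N by (auto simp: B_def)
    ultimately have "\<not> inj_on c {n \<in> B. c n \<notin> J}"
      using card_inj_on_le[of c "{n \<in> B. c n \<notin> J}" "{..<k}"] by auto
    then obtain n n' where nn: "n \<in> B" "n' \<in> B" "n \<noteq> n'" "c n = c n'" "c n \<notin> J"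
      unfolding inj_on_def by auto
    show ?thesis
    proof (intro exI[of _ "insert (c n) J"] conjI ballI)
      show "insert (c n) J \<subseteq> {..<k}" using J(1) nn(1) c N by (auto simp: B_def)
      show "card (insert (c n) J) = Suc j" using finJ J(2) nn(5) by simp
      fix i assume "i \<in> insert (c n) J"
      then consider "i = c n" | "i \<in> J" by blast
      then show "\<exists>u<N1. \<exists>v<N1. u \<noteq> v \<and> c u = i \<and> c v = i"
      proof cases
        case 1
        then show ?thesis using nn
          by (intro exI[of _ n] conjI exI[of _ n']) (auto simp: B_def)
      next
        case 2
        then show ?thesis using uv[OF 2] N1(1) by (metis less_le_trans)
      qed
    qed
  qed
  then have "forces_repeated_colours k (Suc j) N1" unfolding forces_repeated_colours_def by blast
  then show ?case by blast
qed

text \<open>With \<open>k\<close> colours, \<open>k + 1\<close> distinct repeated colours would be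
  forced; so \<open>k\<close> colours never suffice.\<close>

lemma degenerate_bound_tight:
  "\<exists>H :: nat graph. simple_graph H \<and> degenerate (2 * k) H \<and> chromatic_number1 H = k + 1"
proof -
  obtain N0 where N0: "forces_repeated_colours k (k + 1) N0"
    using back_graph_repeated_colours by blast
  \<comment> \<open>The maximum with 1 guards against an empty vertex set.\<close>
  define H where "H = back_graph k (max N0 1)"
  have H: "simple_graph H" unfolding H_def by (rule simple_back_graph) simp
  have d: "degenerate (2 * k) H" unfolding H_def by (rule degenerate_back_graph)
  have "\<not> chromatic_number1 H \<le> k"
  proof
    assume "chromatic_number1 H \<le> k"
    then obtain f c where fc: "one_selection H f" "c \<in> verts H \<rightarrow> {..<k}"
      "\<And>u v. {u, v} \<in> edges H \<Longrightarrow> c u = c v \<Longrightarrow> {u, v} \<in> f ` verts H"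
      using chromatic_number1_leE[OF H] by blast
    have verts: "verts H = {..<max N0 1}" by (simp add: H_def back_graph_def)
    obtain J where "J \<subseteq> {..<k}" "card J = k + 1"
      using forces_repeated_coloursD[OF N0 max.cobounded1 fc(1)[unfolded H_def] fc(2)[unfolded verts]
          fc(3)[unfolded verts, unfolded H_def]] by auto
    then show False using card_mono[of "{..<k}" J] by simp
  qed
  moreover have "chromatic_number1 H \<le> k + 1" using chromatic_number1_degenerate[OF H d] by simp
  ultimately show ?thesis using H d by (intro exI[of _ H]) simp
qed

theorem theorem2:
  shows
    "((\<forall>G :: 'a graph. simple_graph G \<longrightarrow>
          \<lceil>real (chromatic_number G) / 3\<rceil> \<le> int (chromatic_number1 G) \<and>
          chromatic_number1 G \<le> chromatic_number G \<and>
          \<lceil>real (clique_number G) / 3\<rceil> \<le> int (clique_number1 G) \<and>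
          clique_number1 G \<le> clique_number G) \<and>
      (\<forall>k\<ge>1. \<exists>G :: nat graph. simple_graph G \<and> chromatic_number G = k \<and>
          \<lceil>real (chromatic_number G) / 3\<rceil> = int (chromatic_number1 G)) \<and>
      (\<forall>k\<ge>1. \<exists>G :: nat graph. simple_graph G \<and> chromatic_number G = k \<and>
          chromatic_number1 G = chromatic_number G) \<and>
      (\<forall>k\<ge>1. \<exists>G :: nat graph. simple_graph G \<and> clique_number G = k \<and>
          \<lceil>real (clique_number G) / 3\<rceil> = int (clique_number1 G)) \<and>
      (\<forall>k\<ge>1. \<exists>G :: nat graph. simple_graph G \<and> clique_number G = k \<and>
          clique_number1 G = clique_number G))
     \<and>
     ((\<forall>G :: 'a graph. simple_graph G \<and> no_isolated_vertices G \<longrightarrow>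
          clique_cover_number G \<le> clique_cover_number1 G \<and>
          clique_cover_number1 G \<le> 3 * clique_cover_number G) \<and>
      (\<exists>G :: nat graph. simple_graph G \<and> no_isolated_vertices G \<and>
          clique_cover_number1 G = 3 * clique_cover_number G))
     \<and>
     ((\<forall>G :: 'a graph. simple_graph G \<longrightarrow>
          real (vertex_arboricity G) / 2 \<le> real (chromatic_number1 G) \<and>
          chromatic_number1 G \<le> vertex_arboricity G) \<and>
      (\<exists>G :: nat graph. simple_graph G \<and>
          real (vertex_arboricity G) / 2 = real (chromatic_number1 G)) \<and>
      (\<exists>G :: nat graph. simple_graph G \<and>
          chromatic_number1 G = vertex_arboricity G))
     \<and>
     ((\<forall>k\<ge>1. \<forall>G :: 'a graph. simple_graph G \<and> max_degree G < 3 * k \<longrightarrow>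
          chromatic_number1 G \<le> k) \<and>
      (\<forall>G :: 'a graph. simple_graph G \<longrightarrow>
          int (chromatic_number1 G) \<le> \<lceil>real (max_degree G + 1) / 3\<rceil>) \<and>
      (\<forall>k\<ge>1. \<exists>G :: nat graph. simple_graph G \<and>
          max_degree G = 3 * k \<and> chromatic_number1 G = k + 1))
     \<and>
     ((\<forall>d. \<forall>G :: 'a graph. simple_graph G \<and> degenerate d G \<longrightarrow>
          real (chromatic_number1 G) \<le> real d / 2 + 1) \<and>
      (\<forall>k\<ge>1. \<exists>H :: nat graph. simple_graph H \<and>
          degenerate (2 * k) H \<and> chromatic_number1 H = k + 1))
     \<and>
     ((\<forall>G :: 'a graph. simple_graph G \<and> max_degree G > 1 \<longrightarrow>
          int (chromatic_index1 G) \<le> int (chromatic_index G) - 2 \<and>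
          int (min_degree G) - 2 \<le> int (chromatic_index1 G) \<and>
          int (chromatic_index1 G) \<le> int (max_degree G) - 1) \<and>
      (\<exists>G :: nat graph. simple_graph G \<and> max_degree G > 1 \<and>
          int (chromatic_index1 G) = int (chromatic_index G) - 2) \<and>
      (\<exists>G :: nat graph. simple_graph G \<and> max_degree G > 1 \<and>
          int (min_degree G) - 2 = int (chromatic_index1 G)) \<and>
      (\<exists>G :: nat graph. simple_graph G \<and> max_degree G > 1 \<and>
          int (chromatic_index1 G) = int (max_degree G) - 1))"
proof (intro conjI)
  show "\<forall>G :: 'a graph. simple_graph G \<longrightarrow>
      \<lceil>real (chromatic_number G) / 3\<rceil> \<le> int (chromatic_number1 G) \<and>
      chromatic_number1 G \<le> chromatic_number G \<and>
      \<lceil>real (clique_number G) / 3\<rceil> \<le> int (clique_number1 G) \<and>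
      clique_number1 G \<le> clique_number G"
  proof (intro allI impI conjI)
    fix G :: "'a graph" assume G: "simple_graph G"
    show "\<lceil>real (chromatic_number G) / 3\<rceil> \<le> int (chromatic_number1 G)"
      unfolding ceiling_third using chromatic_number_le_three_chromatic_number1[OF G] by linarith
    show "chromatic_number1 G \<le> chromatic_number G" by (rule chromatic_number1_le_chromatic_number[OF G])
    show "\<lceil>real (clique_number G) / 3\<rceil> \<le> int (clique_number1 G)"
      unfolding ceiling_third using clique_number_le_three_clique_number1[OF G] by linarith
    show "clique_number1 G \<le> clique_number G" by (rule clique_number1_le_clique_number[OF G])
  qed
  show "\<forall>k\<ge>1. \<exists>G :: nat graph. simple_graph G \<and> chromatic_number G = k \<and>
      \<lceil>real (chromatic_number G) / 3\<rceil> = int (chromatic_number1 G)"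
    using simple_complete_graph numbers_complete_graph(2) numbers1_complete_graph(1) ceiling_third
    by metis
  show "\<forall>k\<ge>1. \<exists>G :: nat graph. simple_graph G \<and> chromatic_number G = k \<and>
      chromatic_number1 G = chromatic_number G"
    using complete_multipartite_numbers by metis
  show "\<forall>k\<ge>1. \<exists>G :: nat graph. simple_graph G \<and> clique_number G = k \<and>
      \<lceil>real (clique_number G) / 3\<rceil> = int (clique_number1 G)"
    using simple_complete_graph numbers_complete_graph(1) numbers1_complete_graph(2) ceiling_third
    by metis
  show "\<forall>k\<ge>1. \<exists>G :: nat graph. simple_graph G \<and> clique_number G = k \<and>
      clique_number1 G = clique_number G"
    using complete_multipartite_numbers by metis
next
  show "\<forall>G :: 'a graph. simple_graph G \<and> no_isolated_vertices G \<longrightarrow>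
      clique_cover_number G \<le> clique_cover_number1 G \<and>
      clique_cover_number1 G \<le> 3 * clique_cover_number G"
    using clique_cover_number_le_clique_cover_number1
      clique_cover_number1_le_three_clique_cover_number by blast
  have "no_isolated_vertices (complete_graph 3)"
    unfolding no_isolated_vertices_def
  proof
    fix v assume "v \<in> verts (complete_graph 3)"
    then have "{v, if v = 0 then 1 else 0} \<in> edges (complete_graph 3)" by auto
    then show "\<exists>e\<in>edges (complete_graph 3). v \<in> e" by blast
  qed
  then show "\<exists>G :: nat graph. simple_graph G \<and> no_isolated_vertices G \<and>
      clique_cover_number1 G = 3 * clique_cover_number G"
    using simple_complete_graph[of 3] clique_cover_number1_triangle
    by (intro exI[of _ "complete_graph 3"]) simp
next
  show "\<forall>G :: 'a graph. simple_graph G \<longrightarrow>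
      real (vertex_arboricity G) / 2 \<le> real (chromatic_number1 G) \<and>
      chromatic_number1 G \<le> vertex_arboricity G"
  proof (intro allI impI conjI)
    fix G :: "'a graph" assume G: "simple_graph G"
    show "real (vertex_arboricity G) / 2 \<le> real (chromatic_number1 G)"
      using vertex_arboricity_le_two_chromatic_number1[OF G] by linarith
    show "chromatic_number1 G \<le> vertex_arboricity G"
      by (rule chromatic_number1_le_vertex_arboricity[OF G])
  qed
  show "\<exists>G :: nat graph. simple_graph G \<and>
      real (vertex_arboricity G) / 2 = real (chromatic_number1 G)"
    using simple_complete_graph[of 3] vertex_arboricity_triangle numbers1_complete_graph(1)[of 3]
    by (intro exI[of _ "complete_graph 3"]) simp
  show "\<exists>G :: nat graph. simple_graph G \<and> chromatic_number1 G = vertex_arboricity G"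
    using simple_complete_graph[of 1] vertex_arboricity_one_vertex numbers1_complete_graph(1)[of 1]
    by (intro exI[of _ "complete_graph 1"]) simp
next
  show "\<forall>k\<ge>1. \<forall>G :: 'a graph. simple_graph G \<and> max_degree G < 3 * k \<longrightarrow>
      chromatic_number1 G \<le> k"
    using max_degree_less_chromatic_number1 by blast
  show "\<forall>G :: 'a graph. simple_graph G \<longrightarrow>
      int (chromatic_number1 G) \<le> \<lceil>real (max_degree G + 1) / 3\<rceil>"
  proof (intro allI impI)
    fix G :: "'a graph" assume G: "simple_graph G"
    \<comment> \<open>This quotient is the rounded-up third supplied by
      \<open>ceiling_third\<close>.\<close>
    have "max_degree G < 3 * ((max_degree G + 1 + 2) div 3)" by linarith
    then show "int (chromatic_number1 G) \<le> \<lceil>real (max_degree G + 1) / 3\<rceil>"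
      unfolding ceiling_third of_nat_le_iff by (rule max_degree_less_chromatic_number1[OF G])
  qed
  show "\<forall>k\<ge>1. \<exists>G :: nat graph. simple_graph G \<and>
      max_degree G = 3 * k \<and> chromatic_number1 G = k + 1"
  proof (intro allI impI)
    fix k :: nat assume "k \<ge> 1"
    show "\<exists>G :: nat graph. simple_graph G \<and> max_degree G = 3 * k \<and> chromatic_number1 G = k + 1"
      using simple_complete_graph[of "3 * k + 1"] max_degree_complete_graph[of "3 * k + 1"]
        numbers1_complete_graph(1)[of "3 * k + 1"]
      by (intro exI[of _ "complete_graph (3 * k + 1)"]) simp
  qed
next
  show "\<forall>d. \<forall>G :: 'a graph. simple_graph G \<and> degenerate d G \<longrightarrow>
      real (chromatic_number1 G) \<le> real d / 2 + 1"
  proof (intro allI impI)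
    fix d and G :: "'a graph" assume "simple_graph G \<and> degenerate d G"
    then have "chromatic_number1 G \<le> d div 2 + 1" using chromatic_number1_degenerate by blast
    then have "2 * chromatic_number1 G \<le> d + 2" by linarith
    then show "real (chromatic_number1 G) \<le> real d / 2 + 1" by linarith
  qed
  show "\<forall>k\<ge>1. \<exists>H :: nat graph. simple_graph H \<and>
      degenerate (2 * k) H \<and> chromatic_number1 H = k + 1"
    using degenerate_bound_tight by blast
next
  show "\<forall>G :: 'a graph. simple_graph G \<and> max_degree G > 1 \<longrightarrow>
      int (chromatic_index1 G) \<le> int (chromatic_index G) - 2 \<and>
      int (min_degree G) - 2 \<le> int (chromatic_index1 G) \<and>
      int (chromatic_index1 G) \<le> int (max_degree G) - 1"
  proof (intro allI impI)
    fix G :: "'a graph" assume "simple_graph G \<and> max_degree G > 1"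
    then have "chromatic_index1 G + 2 \<le> chromatic_index G" "min_degree G \<le> chromatic_index1 G + 2"
        "chromatic_index G \<le> max_degree G + 1"
      using chromatic_index1_le_chromatic_index min_degree_le_chromatic_index1 vizing by blast+
    then show "int (chromatic_index1 G) \<le> int (chromatic_index G) - 2 \<and>
        int (min_degree G) - 2 \<le> int (chromatic_index1 G) \<and>
        int (chromatic_index1 G) \<le> int (max_degree G) - 1" by linarith
  qed
  show "\<exists>G :: nat graph. simple_graph G \<and> max_degree G > 1 \<and>
      int (chromatic_index1 G) = int (chromatic_index G) - 2"
    using simple_complete_graph[of 5] max_degree_complete_graph[of 5] chromatic_indices_K5
    by (intro exI[of _ "complete_graph 5"]) simp
  show "\<exists>G :: nat graph. simple_graph G \<and> max_degree G > 1 \<and>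
      int (min_degree G) - 2 = int (chromatic_index1 G)"
    using simple_complete_graph[of 3] max_degree_complete_graph[of 3]
      min_degree_complete_graph[of 3] chromatic_index1_triangle
    by (intro exI[of _ "complete_graph 3"]) simp
  show "\<exists>G :: nat graph. simple_graph G \<and> max_degree G > 1 \<and>
      int (chromatic_index1 G) = int (max_degree G) - 1"
    using simple_complete_graph[of 5] max_degree_complete_graph[of 5] chromatic_indices_K5
    by (intro exI[of _ "complete_graph 5"]) simp
qed

end
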